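(* Let $d\ge2$ and let the conditional intensity $\beta\tilde\lambda$ be locally stable, i.e. for each Gibbs point process with distribution $\mu\in\mathcal{G}(\beta,\tilde\lambda)$ there exists a constant $c^*$ such that $\beta\tilde\lambda(x\mid\xi)\le c^*$ for all $x\in\mathbb{R}^d$ and for $\mu$-a.e. $\xi\in\mathfrak{N}$. Then for all $R>0$ there exists a $\beta_->0$ such that for all $\beta<\beta_-$ and for all Gibbs point processes $\Xi$ with distribution in $\mathcal{G}(\beta,\tilde\lambda)$, the set $Z_R(\Xi)=\bigcup_{x\in\Xi}\mathbb{B}_R(x)$ contains almost surely only finite clusters.
   Context: Spaces. Let $d\ge2$; $\mathbb{B}_R(x)$ is the open Euclidean ball of radius $R$ around $x$, $\Lambda^{\mathsf c}=\mathbb{R}^d\setminus\Lambda$. $(\mathfrak{N},\mathcal{N})$ is the space of locally finite point measures on $\mathbb{R}^d$ with the $\sigma$-algebra generated by the maps $\xi\mapsto\xi(\Lambda)$, $\Lambda$ bounded Borel. A point process is a random element of $\mathfrak{N}$; all point processes are assumed simple (no multiple points), so configurations are treated as locally finite subsets of $\mathbb{R}^d$. $\mathfrak{N}_\Lambda$ is the space of configurations in $\Lambda$, and $\xi|_\Lambda$ is the restriction of $\xi$ to $\Lambda$. Gibbs measures. A potential is a measurable function $\Phi:\mathfrak{N}\to\mathbb{R}\cup\{\infty\}$ (with $e^{-\infty}=0$). For bounded measurable $\Lambda\subset\mathbb{R}^d$, a boundary condition $\omega\in\mathfrak{N}_{\Lambda^{\mathsf c}}$ and $\xi\in\mathfrak{N}_\Lambda$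 put $$u_{\Lambda,\omega}(\xi)=\exp\Big(-\sum_{\xi'\subset\xi,\ \xi'\ne\emptyset,\ \omega'\subset\omega}\Phi(\xi'\cup\omega')\Big),$$ $$\mu_{\Lambda,\omega}(A)=\frac{1}{c_{\Lambda,\omega}}\Big(\mathbf{1}\{\omega\in A\}+\sum_{k\ge1}\frac1{k!}\int_\Lambda\cdots\int_\Lambda\mathbf{1}\{\{x_1,\dots,x_k\}\cup\omega\in A\}\,u_{\Lambda,\omega}(\{x_1,\dots,x_k\})\,dx_1\cdots dx_k\Big),$$ where $c_{\Lambda,\omega}=1+\sum_{k\ge1}\frac1{k!}\int_\Lambda\cdots\int_\Lambda u_{\Lambda,\omega}(\{x_1,\dots,x_k\})\,dx_1\cdots dx_k$. It is a standing assumption that $\Phi$ is such that $\mu_{\Lambda,\omega}$ is well defined for all bounded measurable $\Lambda$ and all $\omega\in\mathfrak{N}_{\Lambda^{\mathsf c}}$. A probability measure $\mu$ on $\mathfrak{N}$ is a Gibbs measure for $\Phi$ if $\mu(A)=\int_{\mathfrak{N}}\mu_{\Lambda,\xi|_{\Lambda^{\mathsf c}}}(A)\,\mu(d\xi)$ for all $A\in\mathcal{N}$ and all bounded measurable $\Lambda\subset\mathbb{R}^d$. A Gibbs point process is a point process whose distribution is a Gibbs measure. Conditional intensity and activity. It is assumed that $\Phi(\{x\})=\Phi(\{0\})$ for all $x\in\mathbb{R}^d$. The activity is $\beta=\exp(-\Phi(\{0\}))$. The conditional intensity is $\lambda(x\mid\xi)=\exp\big(-\sum_{\xi'\subset\xi}\Phi(\{x\}\cup\xi')\big)$,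 and $$\tilde\lambda(x\mid\xi)=\frac{\lambda(x\mid\xi)}{\beta}=\exp\Big(-\sum_{\xi'\subset\xi,\ \xi'\ne\emptyset}\Phi(\{x\}\cup\xi')\Big).$$ $\mathcal{G}(\beta,\tilde\lambda)$ denotes the set of Gibbs measures corresponding to the conditional intensity $\beta\tilde\lambda$. Local stability. A Gibbs point process with distribution $\mu$ and conditional intensity $\lambda$ is called locally stable if there exists a constant $c^*$ such that $\lambda(x\mid\xi)\le c^*$ for all $x\in\mathbb{R}^d$ and for $\mu$-a.e. $\xi\in\mathfrak{N}$. If all Gibbs point processes corresponding to the conditional intensity $\lambda$ are locally stable, $\lambda$ itself is called locally stable. Clusters. A cluster is a connected component of $Z_R(\Xi)=\bigcup_{x\in\Xi}\mathbb{B}_R(x)$; finite means bounded (equivalently, containing only finitely many points of $\Xi$).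
   Formalization: Local stability is assumed with c* = βC, one constant C for all small activities β and all μ in G(β,λ̃); with c* depending freely on β the claim fails. Activities are positive, and β_- is given per sample-space type (the canonical one serves all). *)

theory Defs
  imports "HOL-Probability.Probability"
begin

section \<open>Configurations\<close>

definition locally_finite :: "'a::euclidean_space set \<Rightarrow> bool" where
  "locally_finite \<xi> \<longleftrightarrow> (\<forall>B. bounded B \<longrightarrow> finite (\<xi> \<inter> B))"

text \<open>Only simple point measures are used, so a point measure is identified with its support
  and the counting map of \<open>\<Lambda>\<close> is \<open>\<xi> \<mapsto> card (\<xi> \<inter> \<Lambda>)\<close>.\<close>

definition conf_space :: "'a::euclidean_space set measure" where
  "conf_space = sigma {\<xi>. locally_finite \<xi>}
     {{\<xi>. locally_finite \<xi> \<and> card (\<xi> \<inter> \<Lambda>) = n} |\<Lambda> n. bounded \<Lambda> \<and> \<Lambda> \<in> sets borel}"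

section \<open>Gibbs measures\<close>

text \<open>The map \<open>s \<mapsto> exp (- s)\<close> with \<open>exp (- \<infinity>) = 0\<close>.\<close>

definition exp_neg :: "ereal \<Rightarrow> ennreal" where
  "exp_neg s = (case s of ereal r \<Rightarrow> ennreal (exp (- r)) | PInfty \<Rightarrow> 0 | MInfty \<Rightarrow> \<infinity>)"

text \<open>The sums range over all subsets of the boundary condition, finite or infinite, and are
  unordered sums in the extended reals. A potential that is given on finite configurations only
  is covered by setting it to 0 on infinite ones.\<close>

definition energy :: "('a::euclidean_space set \<Rightarrow> ereal) \<Rightarrow> 'a set \<Rightarrow> 'a set \<Rightarrow> ereal" where
  "energy \<Phi> \<omega> \<xi> = (\<Sum>\<^sub>\<infinity>(\<xi>', \<omega>')\<in>(Pow \<xi> - {{}}) \<times> Pow \<omega>. \<Phi> (\<xi>' \<union> \<omega>'))"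

definition boltzmann :: "('a::euclidean_space set \<Rightarrow> ereal) \<Rightarrow> 'a set \<Rightarrow> 'a set \<Rightarrow> ennreal" where
  "boltzmann \<Phi> \<omega> \<xi> = exp_neg (energy \<Phi> \<omega> \<xi>)"

text \<open>The numerator of \<open>\<mu>\<^bsub>\<Lambda>,\<omega>\<^esub>(A)\<close>; a vector \<open>(x\<^sub>1, \<dots>, x\<^sub>k)\<close> is a function on \<open>{..<k}\<close>.\<close>

definition gibbs_weight ::
    "('a::euclidean_space set \<Rightarrow> ereal) \<Rightarrow> 'a set \<Rightarrow> 'a set \<Rightarrow> 'a set set \<Rightarrow> ennreal" where
  "gibbs_weight \<Phi> \<Lambda> \<omega> A = indicator A \<omega> +
     (\<Sum>j. let k = Suc j in
        (\<integral>\<^sup>+x\<in>({..<k} \<rightarrow>\<^sub>E \<Lambda>). indicator A (x ` {..<k} \<union> \<omega>) * boltzmann \<Phi> \<omega> (x ` {..<k})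
           \<partial>(\<Pi>\<^sub>M i\<in>{..<k}. lborel)) / ennreal (fact k))"

definition partition_function ::
    "('a::euclidean_space set \<Rightarrow> ereal) \<Rightarrow> 'a set \<Rightarrow> 'a set \<Rightarrow> ennreal" where
  "partition_function \<Phi> \<Lambda> \<omega> = gibbs_weight \<Phi> \<Lambda> \<omega> UNIV"

definition gibbs_kernel ::
    "('a::euclidean_space set \<Rightarrow> ereal) \<Rightarrow> 'a set \<Rightarrow> 'a set \<Rightarrow> 'a set set \<Rightarrow> ennreal" where
  "gibbs_kernel \<Phi> \<Lambda> \<omega> A = gibbs_weight \<Phi> \<Lambda> \<omega> A / partition_function \<Phi> \<Lambda> \<omega>"

text \<open>The standing assumption that \<open>\<mu>\<^bsub>\<Lambda>,\<omega>\<^esub>\<close> is well defined: the sums exist in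
  \<open>(-\<infinity>, \<infinity>]\<close>, the integrands are measurable, the normalising constant is finite, and the
  kernel can be integrated over the boundary condition.\<close>

definition well_defined :: "('a::euclidean_space set \<Rightarrow> ereal) \<Rightarrow> bool" where
  "well_defined \<Phi> \<longleftrightarrow> (\<forall>\<Lambda>. bounded \<Lambda> \<and> \<Lambda> \<in> sets borel \<longrightarrow>
     (\<forall>\<omega>. locally_finite \<omega> \<and> \<omega> \<subseteq> - \<Lambda> \<longrightarrow>
        (\<forall>\<xi>. finite \<xi> \<and> \<xi> \<subseteq> \<Lambda> \<longrightarrow>
           (\<lambda>(\<xi>', \<omega>'). \<Phi> (\<xi>' \<union> \<omega>')) summable_on ((Pow \<xi> - {{}}) \<times> Pow \<omega>) \<and>
           energy \<Phi> \<omega> \<xi> \<noteq> -\<infinity>) \<and>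
        (\<forall>k::nat. (\<lambda>x. boltzmann \<Phi> \<omega> (x ` {..<k}) * indicator ({..<k} \<rightarrow>\<^sub>E \<Lambda>) x)
           \<in> borel_measurable (\<Pi>\<^sub>M i\<in>{..<k}. lborel)) \<and>
        partition_function \<Phi> \<Lambda> \<omega> < \<infinity>) \<and>
     (\<forall>A\<in>sets conf_space. (\<lambda>\<xi>. gibbs_kernel \<Phi> \<Lambda> (\<xi> - \<Lambda>) A) \<in> borel_measurable conf_space))"

text \<open>The value at a single point is required to be finite, so that the activity is positive
  and the division by it in the definition of the reduced intensity makes sense.\<close>

definition potential :: "('a::euclidean_space set \<Rightarrow> ereal) \<Rightarrow> bool" where
  "potential \<Phi> \<longleftrightarrow> \<Phi> \<in> borel_measurable conf_space \<and>
     (\<forall>\<xi>. locally_finite \<xi> \<longrightarrow> \<Phi> \<xi> \<noteq> -\<infinity>) \<and>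
     (\<forall>x. \<Phi> {x} = \<Phi> {0}) \<and> \<Phi> {0} \<noteq> \<infinity> \<and>
     well_defined \<Phi>"

definition gibbs_measures ::
    "('a::euclidean_space set \<Rightarrow> ereal) \<Rightarrow> 'a set measure set" where
  "gibbs_measures \<Phi> = {\<mu>. prob_space \<mu> \<and> sets \<mu> = sets conf_space \<and>
     (\<forall>\<Lambda>. bounded \<Lambda> \<and> \<Lambda> \<in> sets borel \<longrightarrow> (\<forall>A\<in>sets conf_space.
        emeasure \<mu> A = (\<integral>\<^sup>+\<xi>. gibbs_kernel \<Phi> \<Lambda> (\<xi> - \<Lambda>) A \<partial>\<mu>)))}"

section \<open>Activity and conditional intensity\<close>

definition activity :: "('a::euclidean_space set \<Rightarrow> ereal) \<Rightarrow> real" where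
  "activity \<Phi> = exp (- real_of_ereal (\<Phi> {0}))"

text \<open>The conditional intensity divided by the activity.\<close>

definition reduced_intensity ::
    "('a::euclidean_space set \<Rightarrow> ereal) \<Rightarrow> 'a \<Rightarrow> 'a set \<Rightarrow> ennreal" where
  "reduced_intensity \<Phi> x \<xi> = exp_neg (\<Sum>\<^sub>\<infinity>\<xi>'\<in>Pow \<xi> - {{}}. \<Phi> (insert x \<xi>'))"

text \<open>Changing the activity to \<open>\<beta>\<close> while keeping the reduced intensity means changing the
  potential on one-point configurations only. Thus \<open>gibbs_measures (with_activity \<beta> \<Phi>)\<close> is the
  set of Gibbs measures with conditional intensity \<open>\<beta>\<close> times \<open>reduced_intensity \<Phi>\<close>.\<close>

definition with_activity ::
    "real \<Rightarrow> ('a::euclidean_space set \<Rightarrow> ereal) \<Rightarrow> 'a set \<Rightarrow> ereal" where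
  "with_activity \<beta> \<Phi> \<xi> = (if is_singleton \<xi> then ereal (- ln \<beta>) else \<Phi> \<xi>)"

definition locally_stable ::
    "'a::euclidean_space set measure \<Rightarrow> ('a \<Rightarrow> 'a set \<Rightarrow> ennreal) \<Rightarrow> real \<Rightarrow> bool" where
  "locally_stable \<mu> lam c \<longleftrightarrow> (AE \<xi> in \<mu>. \<forall>x. lam x \<xi> \<le> ennreal c)"

text \<open>Local stability of \<open>\<beta>\<close> times the reduced intensity for all activities \<open>\<beta>\<close> up to that of
  \<open>\<Phi>\<close>. The local stability constant of activity \<open>\<beta>\<close> is of the form \<open>\<beta> * C\<close>, with one \<open>C\<close>
  for all of these activities. If the constants could depend on \<open>\<beta>\<close> in an arbitrary way, nothing
  would force them to become small for small activities.\<close>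

definition locally_stable_intensity :: "('a::euclidean_space set \<Rightarrow> ereal) \<Rightarrow> bool" where
  "locally_stable_intensity \<Phi> \<longleftrightarrow>
     (\<exists>C. \<forall>\<beta>. 0 < \<beta> \<and> \<beta> \<le> activity \<Phi> \<longrightarrow>
        (\<forall>\<mu>\<in>gibbs_measures (with_activity \<beta> \<Phi>).
           locally_stable \<mu> (\<lambda>x \<xi>. ennreal \<beta> * reduced_intensity \<Phi> x \<xi>) (\<beta> * C)))"

section \<open>The Boolean model\<close>

definition boolean_model :: "real \<Rightarrow> 'a::euclidean_space set \<Rightarrow> 'a set" where
  "boolean_model R \<xi> = (\<Union>x\<in>\<xi>. ball x R)"

definition point_process :: "'w measure \<Rightarrow> ('w \<Rightarrow> 'a::euclidean_space set) \<Rightarrow> bool" where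
  "point_process P X \<longleftrightarrow> prob_space P \<and> X \<in> P \<rightarrow>\<^sub>M conf_space"

end

theory Submission
  imports Defs
begin

text \<open>Stochastic domination by a Poisson process is replaced by an elementary estimate. Adding a
  point to a configuration multiplies the Boltzmann factor by the conditional intensity, which is at
  most \<open>\<beta> * C\<close>. Hence, whatever the configuration outside a bounded set of volume at most \<open>L\<close>,
  this set contains a point with probability at most \<open>\<beta> * C * exp L\<close>. Resampling one set after the
  other bounds the probability that \<open>n\<close> disjoint such sets all contain a point by the \<open>n\<close>-th
  power of this number. An unbounded cluster yields self-avoiding paths of arbitrary length through
  nonempty cubes of side length \<open>2 * R\<close>, and there are only exponentially many such paths.\<close>

section \<open>Unordered sums in the extended reals\<close>

text \<open>Stability is known only for \<mu>-almost every configuration, whereas the kernel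
  integrates over Lebesgue-almost every filling of \<open>\<Lambda>\<close>. The bridge is the Gibbs
  equation itself: a \<mu>-null set has kernel probability zero for \<mu>-almost every boundary
  condition. This yields the bound only at fillings with positive Boltzmann factor, which is enough:
  points are added one at a time, and a factor that has become zero stays zero. The constant
  \<open>\<beta> * C * exp L\<close> arises as follows. If \<open>\<beta> * C \<le> 1\<close>,
  almost every filling by k \<ge> 1 points has Boltzmann factor at most \<open>\<beta> * C\<close>,
  so the nonempty fillings weigh at most this number times the sum of L^k / k!, while the
  normalising constant is at least 1. Since \<open>C\<close> bounds the intensity divided by the
  activity and serves all small activities, the estimate tends to 0 with \<open>\<beta>\<close> and
  beats the growth rate of the lattice paths, at most 3^d.\<close>

text \<open>Addition on \<open>ereal\<close> is discontinuous only where \<infinity> meets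
  -\<infinity>; excluding -\<infinity> for both sums lets the limits of the partial sums be
  added.\<close>

lemma has_sum_Un_disjoint_ereal:
  fixes f :: "'b \<Rightarrow> ereal"
  assumes f: "(f has_sum a) A" "(f has_sum b) B" and disj: "A \<inter> B = {}"
    and a: "a \<noteq> -\<infinity>" and b: "b \<noteq> -\<infinity>"
  shows "(f has_sum (a + b)) (A \<union> B)"
proof -
  define fA fB where "fA x = (if x \<in> A then f x else 0)"
    and "fB x = (if x \<notin> A then f x else 0)" for x
  have "(fA has_sum a) (A \<union> B) \<longleftrightarrow> (f has_sum a) A"
    by (rule has_sum_cong_neutral) (auto simp: fA_def)
  moreover have "(fB has_sum b) (A \<union> B) \<longleftrightarrow> (f has_sum b) B"
    by (rule has_sum_cong_neutral) (use disj in \<open>auto simp: fB_def\<close>)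
  moreover have "sum f = (\<lambda>X. sum fA X + sum fB X)"
    by (intro ext) (auto simp: fA_def fB_def simp flip: sum.distrib intro!: sum.cong)
  ultimately show ?thesis
    using f a b tendsto_add_ereal_general[of a b] unfolding has_sum_def by simp
qed

text \<open>Partial sums over sets containing \<open>F\<close> differ by one real constant, and
  adding a real constant is continuous even at infinite limits. It serves to change the terms of
  one-point configurations.\<close>

lemma has_sum_perturb_ereal:
  fixes f g :: "'b \<Rightarrow> ereal"
  assumes f: "(f has_sum s) A" and F: "finite F" "F \<subseteq> A"
    and out: "\<And>x. x \<in> A - F \<Longrightarrow> g x = f x"
    and ins: "\<And>x. x \<in> F \<Longrightarrow> g x = f x + ereal (h x)"
  shows "(g has_sum (s + ereal (sum h F))) A"
proof -
  have "sum g X = sum f X + ereal (sum h F)" if X: "finite X" "F \<subseteq> X" "X \<subseteq> A" for X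
  proof -
    have "sum g X = (\<Sum>x\<in>X. f x + (if x \<in> F then ereal (h x) else 0))"
      using X out ins by (intro sum.cong) auto
    also have "\<dots> = sum f X + (\<Sum>x\<in>X. if x \<in> F then ereal (h x) else 0)"
      by (simp add: sum.distrib)
    also have "(\<Sum>x\<in>X. if x \<in> F then ereal (h x) else 0) = (\<Sum>x\<in>X \<inter> F. ereal (h x))"
      using X by (subst sum.inter_restrict) auto
    also have "X \<inter> F = F"
      using X by auto
    finally show ?thesis
      by simp
  qed
  then have "\<forall>\<^sub>F X in finite_subsets_at_top A. sum f X + ereal (sum h F) = sum g X"
    unfolding eventually_finite_subsets_at_top using F by metis
  moreover have "((\<lambda>X. sum f X + ereal (sum h F)) \<longlongrightarrow> s + ereal (sum h F)) (finite_subsets_at_top A)"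
    using f unfolding has_sum_def by (intro tendsto_add_ereal_general) auto
  ultimately show ?thesis
    unfolding has_sum_def by (rule Lim_transform_eventually[rotated])
qed

section \<open>The Boltzmann factor\<close>

lemma exp_neg_add: "a \<noteq> -\<infinity> \<Longrightarrow> b \<noteq> -\<infinity> \<Longrightarrow> exp_neg (a + b) = exp_neg a * exp_neg b"
  by (cases a; cases b) (auto simp: exp_neg_def exp_diff exp_minus field_simps simp flip: ennreal_mult)

lemma exp_neg_ereal: "exp_neg (ereal r) = ennreal (exp (- r))"
  by (simp add: exp_neg_def)

text \<open>Taking the window to be \<open>\<xi>\<close> itself, a bounded Borel set, makes
  \<open>well_defined\<close> apply to every locally finite boundary condition disjoint from
  \<open>\<xi>\<close>. This allows points of a filling to be moved into the boundary
  condition.\<close>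

lemma energy_has_sum:
  assumes "well_defined \<Phi>" "finite \<xi>" "locally_finite \<omega>" "\<omega> \<inter> \<xi> = {}"
  shows "((\<lambda>(\<xi>', \<omega>'). \<Phi> (\<xi>' \<union> \<omega>')) has_sum energy \<Phi> \<omega> \<xi>) ((Pow \<xi> - {{}}) \<times> Pow \<omega>)"
    and "energy \<Phi> \<omega> \<xi> \<noteq> -\<infinity>"
proof -
  have "bounded \<xi> \<and> \<xi> \<in> sets borel" "\<omega> \<subseteq> - \<xi>"
    using assms by (auto simp: finite_imp_bounded borel_closed finite_imp_closed)
  then have "(\<lambda>(\<xi>', \<omega>'). \<Phi> (\<xi>' \<union> \<omega>')) summable_on ((Pow \<xi> - {{}}) \<times> Pow \<omega>) \<and> energy \<Phi> \<omega> \<xi> \<noteq> -\<infinity>"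
    using assms unfolding well_defined_def by blast
  then show "((\<lambda>(\<xi>', \<omega>'). \<Phi> (\<xi>' \<union> \<omega>')) has_sum energy \<Phi> \<omega> \<xi>) ((Pow \<xi> - {{}}) \<times> Pow \<omega>)"
    and "energy \<Phi> \<omega> \<xi> \<noteq> -\<infinity>"
    by (simp_all add: energy_def)
qed

lemma locally_finite_Un_finite: "locally_finite \<omega> \<Longrightarrow> finite \<xi> \<Longrightarrow> locally_finite (\<xi> \<union> \<omega>)"
  by (auto simp: locally_finite_def Int_Un_distrib2)

text \<open>Pairs whose first component contains \<open>x\<close> correspond to subsets of
  \<open>\<xi> \<union> \<omega>\<close>, split into their parts in \<open>\<xi>\<close> and
  \<open>\<omega>\<close>. The points already placed become boundary condition for the new one, so
  the increment is a one-point energy.\<close>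

lemma energy_insert:
  assumes wd: "well_defined \<Phi>" and \<xi>: "finite \<xi>" and \<omega>: "locally_finite \<omega>" "\<omega> \<inter> insert x \<xi> = {}"
    and x: "x \<notin> \<xi>"
  shows "energy \<Phi> \<omega> (insert x \<xi>) = energy \<Phi> \<omega> \<xi> + energy \<Phi> (\<xi> \<union> \<omega>) {x}"
proof -
  let ?f = "\<lambda>(\<xi>', \<omega>'). \<Phi> (\<xi>' \<union> \<omega>')"
  let ?B = "(\<lambda>(\<xi>', \<omega>'). (insert x \<xi>', \<omega>')) ` (Pow \<xi> \<times> Pow \<omega>)"
  have 1: "(?f has_sum energy \<Phi> \<omega> \<xi>) ((Pow \<xi> - {{}}) \<times> Pow \<omega>)" "energy \<Phi> \<omega> \<xi> \<noteq> -\<infinity>"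
    using energy_has_sum[OF wd \<xi> \<omega>(1)] \<omega>(2) by auto
  have 2: "(?f has_sum energy \<Phi> (\<xi> \<union> \<omega>) {x}) ((Pow {x} - {{}}) \<times> Pow (\<xi> \<union> \<omega>))"
    "energy \<Phi> (\<xi> \<union> \<omega>) {x} \<noteq> -\<infinity>"
    using energy_has_sum[OF wd, of "{x}" "\<xi> \<union> \<omega>"] \<omega> x \<xi> locally_finite_Un_finite[of \<omega> \<xi>] by auto
  have "(?f has_sum energy \<Phi> (\<xi> \<union> \<omega>) {x}) ?B"
  proof (subst has_sum_reindex_bij_witness[of _ "\<lambda>(a, \<eta>). (insert x (\<eta> \<inter> \<xi>), \<eta> \<inter> \<omega>)"
        "\<lambda>(\<xi>', \<omega>'). ({x}, (\<xi>' - {x}) \<union> \<omega>')" _ ?f ?f])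
    show "(?f has_sum energy \<Phi> (\<xi> \<union> \<omega>) {x}) ((Pow {x} - {{}}) \<times> Pow (\<xi> \<union> \<omega>))"
      by fact
    fix b assume b: "b \<in> (Pow {x} - {{}}) \<times> Pow (\<xi> \<union> \<omega>)"
    then obtain \<eta> where \<eta>: "b = ({x}, \<eta>)" "\<eta> \<subseteq> \<xi> \<union> \<omega>"
      by (auto simp: subset_singleton_iff)
    have "insert x (\<eta> \<inter> \<xi>) - {x} \<union> \<eta> \<inter> \<omega> = \<eta>"
      using \<eta> \<omega> x by auto
    with \<eta> show "(case case b of (a, \<eta>) \<Rightarrow> (insert x (\<eta> \<inter> \<xi>), \<eta> \<inter> \<omega>) of (\<xi>', \<omega>') \<Rightarrow> ({x}, \<xi>' - {x} \<union> \<omega>')) = b"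
      by simp
  next
    fix a assume a: "a \<in> ?B"
    then obtain \<xi>' \<omega>' where a': "a = (insert x \<xi>', \<omega>')" "\<xi>' \<subseteq> \<xi>" "\<omega>' \<subseteq> \<omega>"
      by auto
    then have "insert x \<xi>' - {x} = \<xi>'" "(\<xi>' \<union> \<omega>') \<inter> \<xi> = \<xi>'" "(\<xi>' \<union> \<omega>') \<inter> \<omega> = \<omega>'"
      using x \<omega> by auto
    with a' show "(case case a of (\<xi>', \<omega>') \<Rightarrow> ({x}, \<xi>' - {x} \<union> \<omega>') of (a, \<eta>) \<Rightarrow> (insert x (\<eta> \<inter> \<xi>), \<eta> \<inter> \<omega>)) = a"
      by simp
    show "?f (case a of (\<xi>', \<omega>') \<Rightarrow> ({x}, \<xi>' - {x} \<union> \<omega>')) = ?f a"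
      using a' by (auto intro!: arg_cong[of _ _ \<Phi>])
  qed (use \<omega> x in \<open>auto\<close>)
  moreover have "((Pow \<xi> - {{}}) \<times> Pow \<omega>) \<inter> ?B = {}"
    using x by auto
  ultimately have "(?f has_sum energy \<Phi> \<omega> \<xi> + energy \<Phi> (\<xi> \<union> \<omega>) {x}) (((Pow \<xi> - {{}}) \<times> Pow \<omega>) \<union> ?B)"
    using 1 2 by (intro has_sum_Un_disjoint_ereal) auto
  also have "((Pow \<xi> - {{}}) \<times> Pow \<omega>) \<union> ?B = (Pow (insert x \<xi>) - {{}}) \<times> Pow \<omega>"
    by (auto simp: Pow_insert)
  finally show ?thesis
    by (simp add: energy_def infsumI)
qed

text \<open>\<open>reduced_intensity\<close> omits from the one-point energy the term of the empty
  set, which is \<open>\<phi>\<close>; being real, it can be subtracted even from an infinite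
  energy.\<close>

lemma exp_neg_energy_singleton:
  assumes wd: "well_defined \<Phi>" and \<eta>: "locally_finite \<eta>" "x \<notin> \<eta>" and \<phi>: "\<Phi> {x} = ereal \<phi>"
  shows "exp_neg (energy \<Phi> \<eta> {x}) = ennreal (exp (- \<phi>)) * reduced_intensity \<Phi> x \<eta>"
proof -
  let ?f = "\<lambda>(\<xi>', \<omega>'). \<Phi> (\<xi>' \<union> \<omega>')"
  let ?g = "\<lambda>\<eta>'. \<Phi> (insert x \<eta>')"
  have 1: "(?f has_sum energy \<Phi> \<eta> {x}) ((Pow {x} - {{}}) \<times> Pow \<eta>)" "energy \<Phi> \<eta> {x} \<noteq> -\<infinity>"
    using energy_has_sum[OF wd, of "{x}" \<eta>] \<eta> by auto
  have "(Pow {x} - {{}}) \<times> Pow \<eta> = Pair {x} ` Pow \<eta>"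
    by (auto simp: subset_singleton_iff)
  with 1 have "(?g has_sum energy \<Phi> \<eta> {x}) (Pow \<eta>)"
    by (simp add: has_sum_reindex inj_on_def o_def)
  \<comment> \<open>The term at the empty set is first set to zero by the perturbation
    \<open>- \<phi>\<close> and then dropped from the index set.\<close>
  then have "((\<lambda>\<eta>'. if \<eta>' = {} then 0 else ?g \<eta>') has_sum
      energy \<Phi> \<eta> {x} + ereal (sum (\<lambda>_. - \<phi>) {{}::'a set})) (Pow \<eta>)"
    by (rule has_sum_perturb_ereal) (auto simp: \<phi>)
  then have "(?g has_sum energy \<Phi> \<eta> {x} - ereal \<phi>) (Pow \<eta> - {{}})"
    by (subst has_sum_cong_neutral[where T = "Pow \<eta>" and g = "\<lambda>\<eta>'. if \<eta>' = {} then 0 else ?g \<eta>'"])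
      (auto simp: minus_ereal_def)
  then have red: "reduced_intensity \<Phi> x \<eta> = exp_neg (energy \<Phi> \<eta> {x} - ereal \<phi>)"
    by (simp add: reduced_intensity_def infsumI)
  have "energy \<Phi> \<eta> {x} = ereal \<phi> + (energy \<Phi> \<eta> {x} - ereal \<phi>)"
    by (cases "energy \<Phi> \<eta> {x}") auto
  moreover have "energy \<Phi> \<eta> {x} - ereal \<phi> \<noteq> -\<infinity>"
    using 1(2) by (cases "energy \<Phi> \<eta> {x}") auto
  ultimately show ?thesis
    unfolding red by (metis exp_neg_add exp_neg_ereal MInfty_neq_ereal(1))
qed

text \<open>The new factor is the conditional intensity at activity \<open>exp (- \<phi>)\<close>.
  Through this identity local stability controls Boltzmann factors.\<close>

lemma boltzmann_insert:
  assumes "well_defined \<Phi>" "finite \<xi>" "locally_finite \<omega>" "\<omega> \<inter> insert x \<xi> = {}" "x \<notin> \<xi>"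
    and "\<Phi> {x} = ereal \<phi>"
  shows "boltzmann \<Phi> \<omega> (insert x \<xi>) =
    ennreal (exp (- \<phi>)) * reduced_intensity \<Phi> x (\<xi> \<union> \<omega>) * boltzmann \<Phi> \<omega> \<xi>"
proof -
  have lf: "locally_finite (\<xi> \<union> \<omega>)"
    using assms by (simp add: locally_finite_Un_finite)
  have "boltzmann \<Phi> \<omega> (insert x \<xi>) = exp_neg (energy \<Phi> \<omega> \<xi>) * exp_neg (energy \<Phi> (\<xi> \<union> \<omega>) {x})"
    unfolding boltzmann_def using assms lf
  proof (subst energy_insert)
    show "exp_neg (energy \<Phi> \<omega> \<xi> + energy \<Phi> (\<xi> \<union> \<omega>) {x}) =
        exp_neg (energy \<Phi> \<omega> \<xi>) * exp_neg (energy \<Phi> (\<xi> \<union> \<omega>) {x})"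
      using assms lf by (intro exp_neg_add energy_has_sum(2)) auto
  qed auto
  also have "exp_neg (energy \<Phi> (\<xi> \<union> \<omega>) {x}) =
      ennreal (exp (- \<phi>)) * reduced_intensity \<Phi> x (\<xi> \<union> \<omega>)"
    using assms lf by (intro exp_neg_energy_singleton) auto
  finally show ?thesis
    by (simp add: boltzmann_def mult_ac)
qed

lemma boltzmann_empty: "boltzmann \<Phi> \<omega> {} = 1"
  using exp_neg_ereal[of 0, folded zero_ereal_def] by (simp add: boltzmann_def energy_def)

text \<open>As \<open>\<omega>\<close> is disjoint from \<open>\<xi>\<close>, the only pairs whose
  union is a single point are \<open>({x}, {})\<close> with \<open>x \<in> \<xi>\<close>. So
  \<open>card \<xi>\<close> terms are shifted, all by the same constant \<open>c\<close>.\<close>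

lemma boltzmann_with_activity:
  assumes wd: "well_defined \<Phi>" and \<xi>: "finite \<xi>" and \<omega>: "locally_finite \<omega>" "\<omega> \<inter> \<xi> = {}"
    and \<phi>: "\<And>x. \<Phi> {x} = ereal \<phi>" and \<beta>: "0 < \<beta>"
  shows "boltzmann (with_activity \<beta> \<Phi>) \<omega> \<xi> = ennreal ((\<beta> / exp (- \<phi>)) ^ card \<xi>) * boltzmann \<Phi> \<omega> \<xi>"
proof -
  let ?f = "\<lambda>(\<xi>', \<omega>'). \<Phi> (\<xi>' \<union> \<omega>')"
  let ?F = "(\<lambda>x. ({x}, {} :: 'a set)) ` \<xi>"
  define c where "c = - ln \<beta> - \<phi>"
  have sing: "p \<in> ?F" if "p \<in> (Pow \<xi> - {{}}) \<times> Pow \<omega>" "is_singleton (fst p \<union> snd p)" for p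
    using that \<omega>(2) by (cases p) (fastforce simp: is_singleton_def Un_singleton_iff)
  have "((\<lambda>(\<xi>', \<omega>'). with_activity \<beta> \<Phi> (\<xi>' \<union> \<omega>')) has_sum
      energy \<Phi> \<omega> \<xi> + ereal (sum (\<lambda>_. c) ?F)) ((Pow \<xi> - {{}}) \<times> Pow \<omega>)"
  proof (rule has_sum_perturb_ereal)
    show "(?f has_sum energy \<Phi> \<omega> \<xi>) ((Pow \<xi> - {{}}) \<times> Pow \<omega>)"
      by (rule energy_has_sum) fact+
    show "?F \<subseteq> (Pow \<xi> - {{}}) \<times> Pow \<omega>"
      by auto
    show "(case p of (\<xi>', \<omega>') \<Rightarrow> with_activity \<beta> \<Phi> (\<xi>' \<union> \<omega>')) = ?f p"
      if "p \<in> (Pow \<xi> - {{}}) \<times> Pow \<omega> - ?F" for p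
    proof -
      have "\<not> is_singleton (fst p \<union> snd p)"
        using that sing[of p] by blast
      then show ?thesis
        by (cases p) (simp add: with_activity_def)
    qed
  qed (use \<xi> in \<open>auto simp: with_activity_def \<phi> c_def\<close>)
  moreover have "sum (\<lambda>_. c) ?F = card \<xi> * c"
    by (simp add: card_image inj_on_def)
  ultimately have "energy (with_activity \<beta> \<Phi>) \<omega> \<xi> = energy \<Phi> \<omega> \<xi> + ereal (card \<xi> * c)"
    unfolding energy_def[of "with_activity \<beta> \<Phi>"] by (simp add: infsumI del: sum_constant)
  moreover have "exp (- (card \<xi> * c)) = (\<beta> / exp (- \<phi>)) ^ card \<xi>"
  proof -
    have "\<beta> / exp (- \<phi>) = exp (- c)"
      using \<beta> by (simp add: c_def exp_add exp_minus field_simps)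
    then show ?thesis
      by (simp flip: exp_of_nat_mult)
  qed
  ultimately show ?thesis
    using energy_has_sum(2)[OF wd \<xi> \<omega>]
    by (simp add: boltzmann_def exp_neg_add exp_neg_ereal mult.commute)
qed

section \<open>The configuration space\<close>

lemma space_conf_space: "space conf_space = {\<xi>. locally_finite \<xi>}"
  unfolding conf_space_def by (rule space_measure_of) auto

lemma sets_conf_space_card:
  assumes "bounded \<Lambda>" "\<Lambda> \<in> sets borel"
  shows "{\<xi>. locally_finite \<xi> \<and> card (\<xi> \<inter> \<Lambda>) = n} \<in> sets conf_space"
  unfolding conf_space_def by (subst sets_measure_of) (use assms in auto)

lemma sets_conf_space_card_le:
  assumes "bounded \<Lambda>" "\<Lambda> \<in> sets borel"
  shows "{\<xi>. locally_finite \<xi> \<and> card (\<xi> \<inter> \<Lambda>) \<le> n} \<in> sets conf_space"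
proof -
  have "{\<xi>. locally_finite \<xi> \<and> card (\<xi> \<inter> \<Lambda>) \<le> n} = (\<Union>m\<le>n. {\<xi>. locally_finite \<xi> \<and> card (\<xi> \<inter> \<Lambda>) = m})"
    by auto
  then show ?thesis
    using sets_conf_space_card[OF assms] by auto
qed

text \<open>\<open>card\<close> is 0 on infinite sets as well; local finiteness and boundedness of
  \<open>\<Lambda>\<close> ensure that count 0 means empty.\<close>

lemma sets_conf_space_meets:
  assumes "bounded \<Lambda>" "\<Lambda> \<in> sets borel"
  shows "{\<xi>. locally_finite \<xi> \<and> \<xi> \<inter> \<Lambda> \<noteq> {}} \<in> sets conf_space"
proof -
  have "{\<xi>. locally_finite \<xi> \<and> \<xi> \<inter> \<Lambda> \<noteq> {}} =
      space conf_space - {\<xi>. locally_finite \<xi> \<and> card (\<xi> \<inter> \<Lambda>) = 0}"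
    using assms(1) by (auto simp: space_conf_space locally_finite_def)
  then show ?thesis
    using sets_conf_space_card[OF assms, of 0] by auto
qed

lemma sets_conf_space_meets_all:
  assumes "finite I" "\<And>i. i \<in> I \<Longrightarrow> bounded (\<Lambda> i)" "\<And>i. i \<in> I \<Longrightarrow> \<Lambda> i \<in> sets borel"
  shows "{\<xi>. locally_finite \<xi> \<and> (\<forall>i\<in>I. \<xi> \<inter> \<Lambda> i \<noteq> {})} \<in> sets conf_space"
proof -
  have "{\<xi>. locally_finite \<xi> \<and> (\<forall>i\<in>I. \<xi> \<inter> \<Lambda> i \<noteq> {})} =
      {\<xi> \<in> space conf_space. \<forall>i\<in>I. \<xi> \<in> {\<xi>. locally_finite \<xi> \<and> \<xi> \<inter> \<Lambda> i \<noteq> {}}}"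
    by (auto simp: space_conf_space)
  also have "\<dots> \<in> sets conf_space"
    by (rule sets.sets_Collect_finite_All[OF _ assms(1)])
      (use sets_conf_space_meets assms in \<open>auto simp: space_conf_space\<close>)
  finally show ?thesis .
qed

section \<open>Measurability of adding sampled points, and null sets under projection\<close>

text \<open>An entry counts if it lies in \<open>\<Lambda>\<close>, off \<open>\<omega>\<close>, and
  differs from all earlier entries. Counting first occurrences copes with repetitions and turns the
  number of points into a finite sum of indicators.\<close>

lemma card_image_Un_Int:
  fixes x :: "nat \<Rightarrow> 'a"
  assumes "finite (\<omega> \<inter> \<Lambda>)"
  shows "card ((x ` {..<k} \<union> \<omega>) \<inter> \<Lambda>) = card (\<omega> \<inter> \<Lambda>) +
    (\<Sum>i<k. if x i \<in> \<Lambda> - \<omega> \<inter> \<Lambda> \<and> (\<forall>j<i. x j \<noteq> x i) then 1 else 0)"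
proof (induction k)
  case (Suc k)
  let ?S = "(x ` {..<k} \<union> \<omega>) \<inter> \<Lambda>"
  have fin: "finite ?S"
    using assms by (simp add: Int_Un_distrib2)
  have "card ((x ` {..<Suc k} \<union> \<omega>) \<inter> \<Lambda>) =
      card ?S + (if x k \<in> \<Lambda> - \<omega> \<inter> \<Lambda> \<and> (\<forall>j<k. x j \<noteq> x k) then 1 else 0)"
  proof (cases "x k \<in> \<Lambda> - \<omega> \<inter> \<Lambda> \<and> (\<forall>j<k. x j \<noteq> x k)")
    case True
    then have "(x ` {..<Suc k} \<union> \<omega>) \<inter> \<Lambda> = insert (x k) ?S" "x k \<notin> ?S"
      by (auto simp: lessThan_Suc)
    then show ?thesis
      using fin unfolding if_P[OF True] by simp
  next
    case False
    then have "x k \<notin> \<Lambda> \<or> x k \<in> \<omega> \<or> x k \<in> x ` {..<k}"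
      by (metis DiffI IntD1 imageI lessThan_iff)
    then have "(x ` {..<Suc k} \<union> \<omega>) \<inter> \<Lambda> = ?S"
      by (auto simp: lessThan_Suc)
    then show ?thesis
      using False by (simp only: if_False)
  qed
  then show ?case
    using Suc by simp
qed simp

lemma measurable_image_Un:
  fixes k :: nat
  assumes "locally_finite \<omega>"
  shows "(\<lambda>x. x ` {..<k} \<union> \<omega>) \<in> (\<Pi>\<^sub>M i\<in>{..<k}. lborel) \<rightarrow>\<^sub>M conf_space"
  unfolding conf_space_def
proof (rule measurable_measure_of)
  let ?M = "\<Pi>\<^sub>M i\<in>{..<k}. (lborel :: 'a measure)"
  show "(\<lambda>x. x ` {..<k} \<union> \<omega>) \<in> space ?M \<rightarrow> {\<xi>. locally_finite \<xi>}"
    using assms by (auto intro: locally_finite_Un_finite)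
  fix Y :: "'a set set"
  assume "Y \<in> {{\<xi>. locally_finite \<xi> \<and> card (\<xi> \<inter> \<Lambda>) = n} |\<Lambda> n. bounded \<Lambda> \<and> \<Lambda> \<in> sets borel}"
  then obtain \<Lambda> n where Y: "Y = {\<xi>. locally_finite \<xi> \<and> card (\<xi> \<inter> \<Lambda>) = n}"
    and \<Lambda>: "bounded \<Lambda>" "\<Lambda> \<in> sets borel"
    by blast
  have fin: "finite (\<omega> \<inter> \<Lambda>)"
    using assms \<Lambda> by (auto simp: locally_finite_def)
  have [measurable]: "(\<lambda>x. x i) \<in> ?M \<rightarrow>\<^sub>M borel" if "i < k" for i
    using measurable_component_singleton[of i "{..<k}" "\<lambda>_. lborel"] that by simp
  have [measurable]: "\<Lambda> - \<omega> \<inter> \<Lambda> \<in> sets borel"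
    using \<Lambda> fin by (auto intro: borel_closed finite_imp_closed)
  \<comment> \<open>Distinctness of two coordinates is read off from their distance, a measurable
    real function.\<close>
  have neq: "Measurable.pred ?M (\<lambda>x. x j \<noteq> x i)" if "i < k" "j < i" for i j
  proof -
    have [measurable]: "(\<lambda>x. dist (x j) (x i)) \<in> borel_measurable ?M"
      using that by (intro borel_measurable_dist) auto
    have "Measurable.pred ?M (\<lambda>x. dist (x j) (x i) \<noteq> 0)"
      by measurable
    then show ?thesis
      by simp
  qed
  have "Measurable.pred ?M (\<lambda>x. x i \<in> \<Lambda> - \<omega> \<inter> \<Lambda> \<and> (\<forall>j\<in>{..<i}. x j \<noteq> x i))" if i: "i < k" for i
  proof (rule pred_intros_logic)
    show "Measurable.pred ?M (\<lambda>x. x i \<in> \<Lambda> - \<omega> \<inter> \<Lambda>)"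
      using i by measurable
    show "Measurable.pred ?M (\<lambda>x. \<forall>j\<in>{..<i}. x j \<noteq> x i)"
      using neq[OF i] by (intro pred_intros_finite(3)) auto
  qed
  then have "(\<lambda>x. real (card (\<omega> \<inter> \<Lambda>)) +
      (\<Sum>i<k. if x i \<in> \<Lambda> - \<omega> \<inter> \<Lambda> \<and> (\<forall>j\<in>{..<i}. x j \<noteq> x i) then 1 else 0)) \<in> borel_measurable ?M"
    by (intro borel_measurable_add borel_measurable_const borel_measurable_sum measurable_If)
      (auto simp: pred_def)
  moreover have "real (card ((x ` {..<k} \<union> \<omega>) \<inter> \<Lambda>)) = real (card (\<omega> \<inter> \<Lambda>)) +
      (\<Sum>i<k. if x i \<in> \<Lambda> - \<omega> \<inter> \<Lambda> \<and> (\<forall>j\<in>{..<i}. x j \<noteq> x i) then 1 else 0)" for x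
    unfolding card_image_Un_Int[OF fin] of_nat_add of_nat_sum by (auto intro!: sum.cong)
  ultimately have "(\<lambda>x. real (card ((x ` {..<k} \<union> \<omega>) \<inter> \<Lambda>))) \<in> borel_measurable ?M"
    by simp
  from measurable_sets[OF this, of "{real n}"]
  show "(\<lambda>x. x ` {..<k} \<union> \<omega>) -` Y \<inter> space ?M \<in> sets ?M"
    using assms by (simp add: Y vimage_def Int_def conj_commute locally_finite_Un_finite)
qed auto

text \<open>Integrating out coordinate \<open>i\<close> multiplies the indicator of a null set by
  the total mass of \<open>M i\<close>, possibly infinite; the product is still zero almost
  everywhere.\<close>

lemma (in product_sigma_finite) AE_PiM_restrict:
  assumes I: "finite I" "i \<notin> I" and P: "AE x in PiM I M. P x"
  shows "AE x in PiM (insert i I) M. P (restrict x I)"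
proof -
  obtain N where N: "{x \<in> space (PiM I M). \<not> P x} \<subseteq> N" "N \<in> null_sets (PiM I M)"
    using P unfolding eventually_ae_filter by blast
  then have [measurable]: "N \<in> sets (PiM I M)"
    by auto
  have [measurable]: "(\<lambda>x. restrict x I) \<in> PiM (insert i I) M \<rightarrow>\<^sub>M PiM I M"
    by (rule measurable_restrict_subset) auto
  have "(\<integral>\<^sup>+x. indicator N (restrict x I) \<partial>PiM (insert i I) M) =
      (\<integral>\<^sup>+x. (\<integral>\<^sup>+y. indicator N (restrict (x(i := y)) I) \<partial>M i) \<partial>PiM I M)"
    by (rule product_nn_integral_insert) (use I in measurable)
  also have "\<dots> = (\<integral>\<^sup>+x. (\<integral>\<^sup>+y. indicator N x \<partial>M i) \<partial>PiM I M)"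
  proof -
    have "restrict (x(i := y)) I = x" if "x \<in> space (PiM I M)" for x y
      using that I by (auto simp: space_PiM fun_eq_iff restrict_def PiE_def extensional_def)
    then show ?thesis
      by (intro nn_integral_cong) simp
  qed
  also have "\<dots> = 0"
    using AE_not_in[OF N(2)] by (subst nn_integral_0_iff_AE) (auto elim!: eventually_mono)
  finally have "AE x in PiM (insert i I) M. indicator N (restrict x I) = (0::ennreal)"
    by (subst (asm) nn_integral_0_iff_AE) auto
  then show ?thesis
  proof (rule AE_mp, intro AE_I2 impI)
    fix x assume "x \<in> space (PiM (insert i I) M)" "indicator N (restrict x I) = (0::ennreal)"
    then have "restrict x I \<in> space (PiM I M)" "restrict x I \<notin> N"
      by (auto simp: space_PiM indicator_def split: if_splits)
    with N(1) show "P (restrict x I)"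
      by auto
  qed
qed

section \<open>Locally stable Gibbs measures at small activity\<close>

lemma ennreal_inverse_antimono: "a \<le> b \<Longrightarrow> inverse b \<le> inverse (a :: ennreal)"
  including ennreal.lifting by transfer (rule ereal_inverse_antimono)

definition gibbs_term ::
    "('a::euclidean_space set \<Rightarrow> ereal) \<Rightarrow> 'a set \<Rightarrow> 'a set \<Rightarrow> 'a set set \<Rightarrow> nat \<Rightarrow> ennreal" where
  "gibbs_term \<Phi> \<Lambda> \<omega> A k = (\<integral>\<^sup>+x\<in>({..<k} \<rightarrow>\<^sub>E \<Lambda>).
     indicator A (x ` {..<k} \<union> \<omega>) * boltzmann \<Phi> \<omega> (x ` {..<k}) \<partial>(\<Pi>\<^sub>M i\<in>{..<k}. lborel))"

lemma gibbs_weight_eq: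
  "gibbs_weight \<Phi> \<Lambda> \<omega> A =
    indicator A \<omega> + (\<Sum>j. gibbs_term \<Phi> \<Lambda> \<omega> A (Suc j) / ennreal (fact (Suc j)))"
  by (simp add: gibbs_weight_def gibbs_term_def Let_def)

lemma gibbs_weight_mono:
  assumes "(indicator A \<omega> :: ennreal) \<le> indicator B \<omega>"
    and "\<And>k. gibbs_term \<Phi> \<Lambda> \<omega> A k \<le> gibbs_term \<Psi> \<Lambda> \<omega> B k"
  shows "gibbs_weight \<Phi> \<Lambda> \<omega> A \<le> gibbs_weight \<Psi> \<Lambda> \<omega> B"
  unfolding gibbs_weight_eq
  by (intro add_mono suminf_le divide_right_mono_ennreal assms) auto

lemma partition_function_ge_1: "1 \<le> partition_function \<Phi> \<Lambda> \<omega>"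
  by (simp add: partition_function_def gibbs_weight_eq)

lemma well_definedD:
  assumes "well_defined \<Phi>" "bounded \<Lambda>" "\<Lambda> \<in> sets borel"
  shows "A \<in> sets conf_space \<Longrightarrow> (\<lambda>\<xi>. gibbs_kernel \<Phi> \<Lambda> (\<xi> - \<Lambda>) A) \<in> borel_measurable conf_space"
    and "locally_finite \<omega> \<Longrightarrow> \<omega> \<subseteq> - \<Lambda> \<Longrightarrow> partition_function \<Phi> \<Lambda> \<omega> < \<infinity>"
    and "locally_finite \<omega> \<Longrightarrow> \<omega> \<subseteq> - \<Lambda> \<Longrightarrow>
      (\<lambda>x. boltzmann \<Phi> \<omega> (x ` {..<k}) * indicator ({..<k} \<rightarrow>\<^sub>E \<Lambda>) x) \<in> borel_measurable (\<Pi>\<^sub>M i\<in>{..<k::nat}. lborel)"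
  using assms by (simp_all add: well_defined_def)

lemma measurable_gibbs_integrand:
  fixes k :: nat
  assumes "well_defined \<Phi>" "bounded \<Lambda>" "\<Lambda> \<in> sets borel" "locally_finite \<omega>" "\<omega> \<subseteq> - \<Lambda>"
    and "A \<in> sets conf_space"
  shows "(\<lambda>x. indicator A (x ` {..<k} \<union> \<omega>) * boltzmann \<Phi> \<omega> (x ` {..<k}) * indicator ({..<k} \<rightarrow>\<^sub>E \<Lambda>) x)
    \<in> borel_measurable (\<Pi>\<^sub>M i\<in>{..<k}. lborel)"
proof -
  have "(\<lambda>x. indicator A (x ` {..<k} \<union> \<omega>) :: ennreal) \<in> borel_measurable (\<Pi>\<^sub>M i\<in>{..<k}. lborel)"
    by (rule measurable_compose[OF measurable_image_Un[OF assms(4)] borel_measurable_indicator]) fact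
  from borel_measurable_times_ennreal[OF this well_definedD(3)[OF assms(1-5)]] show ?thesis
    by (simp add: mult.assoc)
qed

text \<open>\<open>\<phi>\<close> is the one-point value of \<open>\<Phi>\<close>, so
  \<open>\<beta> / exp (- \<phi>)\<close> is the factor per point when the activity is lowered to
  \<open>\<beta>\<close>. The condition \<open>\<beta> * C \<le> 1\<close> allows every positive
  power of \<open>\<beta> * C\<close> to be bounded by \<open>\<beta> * C\<close>.\<close>

locale stable_gibbs =
  fixes \<Phi> :: "'a::euclidean_space set \<Rightarrow> ereal" and \<phi> \<beta> C :: real and \<mu> :: "'a set measure"
  assumes wd: "well_defined \<Phi>"
    and \<phi>: "\<And>x. \<Phi> {x} = ereal \<phi>"
    and \<beta>: "0 < \<beta>" "\<beta> \<le> exp (- \<phi>)"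
    and C: "0 \<le> C" "\<beta> * C \<le> 1"
    and gibbs: "\<mu> \<in> gibbs_measures (with_activity \<beta> \<Phi>)"
    and stable: "AE \<xi> in \<mu>. \<forall>x. reduced_intensity \<Phi> x \<xi> \<le> ennreal C"
begin

abbreviation "\<Psi> \<equiv> with_activity \<beta> \<Phi>"

abbreviation "ratio \<equiv> \<beta> / exp (- \<phi>)"

lemma ratio: "0 < ratio" "ratio \<le> 1"
  using \<beta> by auto

lemma sets_\<mu>: "sets \<mu> = sets conf_space"
  using gibbs by (simp add: gibbs_measures_def)

lemma space_\<mu>: "space \<mu> = {\<xi>. locally_finite \<xi>}"
  using sets_eq_imp_space_eq[OF sets_\<mu>] by (simp add: space_conf_space)

lemma emeasure_\<mu>:
  "bounded \<Lambda> \<Longrightarrow> \<Lambda> \<in> sets borel \<Longrightarrow> A \<in> sets conf_space \<Longrightarrow>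
    emeasure \<mu> A = (\<integral>\<^sup>+\<xi>. gibbs_kernel \<Psi> \<Lambda> (\<xi> - \<Lambda>) A \<partial>\<mu>)"
  using gibbs by (simp add: gibbs_measures_def)

lemma boltzmann_\<Psi>:
  "finite \<xi> \<Longrightarrow> locally_finite \<omega> \<Longrightarrow> \<omega> \<inter> \<xi> = {} \<Longrightarrow>
    boltzmann \<Psi> \<omega> \<xi> = ennreal (ratio ^ card \<xi>) * boltzmann \<Phi> \<omega> \<xi>"
  using wd \<phi> \<beta> by (intro boltzmann_with_activity) auto

lemma boltzmann_\<Psi>_le:
  assumes "finite \<xi>" "locally_finite \<omega>" "\<omega> \<inter> \<xi> = {}"
  shows "boltzmann \<Psi> \<omega> \<xi> \<le> boltzmann \<Phi> \<omega> \<xi>"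
proof -
  have "ennreal (ratio ^ card \<xi>) * boltzmann \<Phi> \<omega> \<xi> \<le> 1 * boltzmann \<Phi> \<omega> \<xi>"
    using ratio by (intro mult_right_mono) (auto intro!: power_le_one)
  then show ?thesis
    using assms by (simp add: boltzmann_\<Psi>)
qed

lemma partition_function_\<Psi>_le:
  assumes "locally_finite \<omega>" "\<omega> \<subseteq> - \<Lambda>"
  shows "partition_function \<Psi> \<Lambda> \<omega> \<le> partition_function \<Phi> \<Lambda> \<omega>"
  unfolding partition_function_def
proof (rule gibbs_weight_mono)
  fix k :: nat
  have "boltzmann \<Psi> \<omega> (x ` {..<k}) \<le> boltzmann \<Phi> \<omega> (x ` {..<k})" if "x \<in> {..<k} \<rightarrow>\<^sub>E \<Lambda>" for x
    using assms that by (intro boltzmann_\<Psi>_le) (auto simp: PiE_iff)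
  then show "gibbs_term \<Psi> \<Lambda> \<omega> UNIV k \<le> gibbs_term \<Phi> \<Lambda> \<omega> UNIV k"
    unfolding gibbs_term_def by (intro nn_integral_mono) (auto split: split_indicator)
qed simp

text \<open>\<open>well_defined\<close> provides measurability of the kernel in the boundary condition for \<open>\<Phi>\<close> only, not
  for \<open>\<Psi>\<close>. On configurations with a bounded number of points in \<open>\<Lambda>\<close> the two are comparable, which
  suffices to transfer null sets.\<close>

lemma gibbs_weight_\<Psi>_ge:
  assumes \<Lambda>: "bounded \<Lambda>" "\<Lambda> \<in> sets borel" and \<omega>: "locally_finite \<omega>" "\<omega> \<subseteq> - \<Lambda>"
    and A: "A \<in> sets conf_space" "\<And>\<xi>. \<xi> \<in> A \<Longrightarrow> card (\<xi> \<inter> \<Lambda>) \<le> m"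
  shows "ennreal (ratio ^ m) * gibbs_weight \<Phi> \<Lambda> \<omega> A \<le> gibbs_weight \<Psi> \<Lambda> \<omega> A"
proof -
  have "ennreal (ratio ^ m) * gibbs_term \<Phi> \<Lambda> \<omega> A k \<le> gibbs_term \<Psi> \<Lambda> \<omega> A k" for k
  proof -
    have "ennreal (ratio ^ m) * (indicator A (x ` {..<k} \<union> \<omega>) * boltzmann \<Phi> \<omega> (x ` {..<k}) * indicator ({..<k} \<rightarrow>\<^sub>E \<Lambda>) x)
      \<le> indicator A (x ` {..<k} \<union> \<omega>) * boltzmann \<Psi> \<omega> (x ` {..<k}) * indicator ({..<k} \<rightarrow>\<^sub>E \<Lambda>) x" for x
    proof (cases "x \<in> {..<k} \<rightarrow>\<^sub>E \<Lambda> \<and> x ` {..<k} \<union> \<omega> \<in> A")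
      case True
      then have x: "x ` {..<k} \<subseteq> \<Lambda>"
        by auto
      \<comment> \<open>The boundary condition lies outside \<open>\<Lambda>\<close>, so the bound
        \<open>m\<close> on the count in \<open>\<Lambda>\<close> bounds the number of factors
        \<open>ratio\<close>.\<close>
      then have "(x ` {..<k} \<union> \<omega>) \<inter> \<Lambda> = x ` {..<k}"
        using \<omega> by auto
      with True A(2) have "card (x ` {..<k}) \<le> m"
        by metis
      then have "ratio ^ m \<le> ratio ^ card (x ` {..<k})"
        using ratio by (intro power_decreasing) auto
      moreover have "\<omega> \<inter> x ` {..<k} = {}"
        using x \<omega> by auto
      ultimately show ?thesis
        using True \<omega> by (auto simp: boltzmann_\<Psi> intro!: mult_right_mono ennreal_leI)
    next
      case False
      then consider "x \<notin> {..<k} \<rightarrow>\<^sub>E \<Lambda>" | "x ` {..<k} \<union> \<omega> \<notin> A"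
        by blast
      then show ?thesis
        by cases simp_all
    qed
    then show ?thesis
      unfolding gibbs_term_def
      by (subst nn_integral_cmult[symmetric])
        (use measurable_gibbs_integrand[OF wd \<Lambda> \<omega> A(1)] in \<open>auto intro!: nn_integral_mono\<close>)
  qed
  then have "(\<Sum>j. ennreal (ratio ^ m) * (gibbs_term \<Phi> \<Lambda> \<omega> A (Suc j) / ennreal (fact (Suc j))))
      \<le> (\<Sum>j. gibbs_term \<Psi> \<Lambda> \<omega> A (Suc j) / ennreal (fact (Suc j)))"
    by (intro suminf_le) (auto simp: ennreal_times_divide intro!: divide_right_mono_ennreal)
  moreover have "ennreal (ratio ^ m) * indicator A \<omega> \<le> (indicator A \<omega> :: ennreal)"
    using ratio by (auto intro!: power_le_one split: split_indicator)
  ultimately show ?thesis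
    unfolding gibbs_weight_eq distrib_left ennreal_suminf_cmult by (rule add_mono[rotated])
qed

section \<open>Carrying the stability bound from \<mu> to the fillings of a window\<close>

text \<open>The Gibbs equation makes the kernel of \<open>\<Psi>\<close> integrate to zero on
  \<open>A\<close>; the kernel of \<open>\<Phi>\<close> lies below a constant multiple of it and is
  measurable in the boundary condition, so it vanishes almost everywhere.\<close>

lemma AE_gibbs_weight_eq_0:
  assumes \<Lambda>: "bounded \<Lambda>" "\<Lambda> \<in> sets borel"
    and A: "A \<in> null_sets \<mu>" "\<And>\<xi>. \<xi> \<in> A \<Longrightarrow> card (\<xi> \<inter> \<Lambda>) \<le> m"
  shows "AE \<xi> in \<mu>. gibbs_weight \<Phi> \<Lambda> (\<xi> - \<Lambda>) A = 0"
proof -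
  have A': "A \<in> sets conf_space"
    using A(1) sets_\<mu> by auto
  have *: "locally_finite (\<xi> - \<Lambda>)" "\<xi> - \<Lambda> \<subseteq> - \<Lambda>" if "\<xi> \<in> space \<mu>" for \<xi>
    using that by (auto simp: space_\<mu> locally_finite_def Diff_Int_distrib2)
  have le: "ennreal (ratio ^ m) * gibbs_kernel \<Phi> \<Lambda> (\<xi> - \<Lambda>) A \<le> gibbs_kernel \<Psi> \<Lambda> (\<xi> - \<Lambda>) A"
    if "\<xi> \<in> space \<mu>" for \<xi>
  proof -
    have inv: "inverse (partition_function \<Phi> \<Lambda> (\<xi> - \<Lambda>)) \<le> inverse (partition_function \<Psi> \<Lambda> (\<xi> - \<Lambda>))"
      using partition_function_\<Psi>_le[OF *[OF that]] by (simp add: ennreal_inverse_antimono)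
    have weight: "ennreal (ratio ^ m) * gibbs_weight \<Phi> \<Lambda> (\<xi> - \<Lambda>) A \<le> gibbs_weight \<Psi> \<Lambda> (\<xi> - \<Lambda>) A"
      by (rule gibbs_weight_\<Psi>_ge[OF \<Lambda> *[OF that] A']) (rule A(2))
    show ?thesis
      unfolding gibbs_kernel_def ennreal_times_divide
      unfolding divide_ennreal_def by (rule mult_mono[OF weight inv]) auto
  qed
  have [measurable]: "(\<lambda>\<xi>. gibbs_kernel \<Phi> \<Lambda> (\<xi> - \<Lambda>) A) \<in> borel_measurable \<mu>"
    unfolding measurable_cong_sets[OF sets_\<mu> refl] by (rule well_definedD(1)[OF wd \<Lambda> A'])
  have "(\<integral>\<^sup>+\<xi>. ennreal (ratio ^ m) * gibbs_kernel \<Phi> \<Lambda> (\<xi> - \<Lambda>) A \<partial>\<mu>) \<le> emeasure \<mu> A"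
    unfolding emeasure_\<mu>[OF \<Lambda> A'] using le by (rule nn_integral_mono)
  also have "emeasure \<mu> A = 0"
    using A(1) by auto
  finally have "AE \<xi> in \<mu>. ennreal (ratio ^ m) * gibbs_kernel \<Phi> \<Lambda> (\<xi> - \<Lambda>) A = 0"
    by (subst (asm) le_zero_eq, subst (asm) nn_integral_0_iff_AE) auto
  then show ?thesis
  proof (rule AE_mp, intro AE_I2 impI)
    fix \<xi> assume \<xi>: "\<xi> \<in> space \<mu>" "ennreal (ratio ^ m) * gibbs_kernel \<Phi> \<Lambda> (\<xi> - \<Lambda>) A = 0"
    moreover have "ennreal (ratio ^ m) \<noteq> 0"
      using ratio by auto
    ultimately have "gibbs_kernel \<Phi> \<Lambda> (\<xi> - \<Lambda>) A = 0"
      by (metis mult_eq_0_iff)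
    \<comment> \<open>Dividing by \<infinity> would also give 0, so finiteness is what passes from
      the kernel to the weight.\<close>
    moreover have "partition_function \<Phi> \<Lambda> (\<xi> - \<Lambda>) < \<infinity>"
      by (rule well_definedD(2)[OF wd \<Lambda> *[OF \<xi>(1)]])
    ultimately show "gibbs_weight \<Phi> \<Lambda> (\<xi> - \<Lambda>) A = 0"
      by (auto simp: gibbs_kernel_def)
  qed
qed

text \<open>Fillings of zero Boltzmann factor are invisible to the kernel, hence the guard. The
  quantifier over \<open>y\<close> stands inside, so that the exceptional null set serves every new
  point.\<close>

definition good :: "'a set \<Rightarrow> 'a set \<Rightarrow> bool" where
  "good \<Lambda> \<omega> \<longleftrightarrow> (\<forall>k::nat. AE x in \<Pi>\<^sub>M i\<in>{..<k}. lborel. x \<in> {..<k} \<rightarrow>\<^sub>E \<Lambda> \<longrightarrow>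
     boltzmann \<Phi> \<omega> (x ` {..<k}) \<noteq> 0 \<longrightarrow>
     (\<forall>y. reduced_intensity \<Phi> y (x ` {..<k} \<union> \<omega>) \<le> ennreal C))"

text \<open>The exceptional set of stability is cut into the countably many pieces
  \<open>N' m\<close> with at most \<open>m\<close> points in \<open>\<Lambda>\<close>, since null
  sets transfer only under such a bound.\<close>

lemma AE_good:
  assumes \<Lambda>: "bounded \<Lambda>" "\<Lambda> \<in> sets borel"
  shows "AE \<xi> in \<mu>. good \<Lambda> (\<xi> - \<Lambda>)"
proof -
  obtain N where N: "N \<in> null_sets \<mu>"
    "{\<xi> \<in> space \<mu>. \<not> (\<forall>x. reduced_intensity \<Phi> x \<xi> \<le> ennreal C)} \<subseteq> N"
    using stable unfolding eventually_ae_filter by blast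
  define N' where "N' m = {\<xi>. locally_finite \<xi> \<and> card (\<xi> \<inter> \<Lambda>) \<le> m} \<inter> N" for m
  have N': "N' m \<in> null_sets \<mu>" for m
    unfolding N'_def using N(1) sets_conf_space_card_le[OF \<Lambda>, of m] sets_\<mu>
    by (intro null_set_Int1) auto
  have "AE \<xi> in \<mu>. gibbs_weight \<Phi> \<Lambda> (\<xi> - \<Lambda>) (N' m) = 0" for m
    by (rule AE_gibbs_weight_eq_0[OF \<Lambda> N', of _ m]) (auto simp: N'_def)
  then have "AE \<xi> in \<mu>. \<forall>m. gibbs_weight \<Phi> \<Lambda> (\<xi> - \<Lambda>) (N' m) = 0"
    by (simp add: AE_all_countable)
  then show ?thesis
  proof (rule AE_mp, intro AE_I2 impI)
    fix \<xi> assume \<xi>: "\<xi> \<in> space \<mu>" "\<forall>m. gibbs_weight \<Phi> \<Lambda> (\<xi> - \<Lambda>) (N' m) = 0"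
    define \<omega> where "\<omega> = \<xi> - \<Lambda>"
    have \<omega>: "locally_finite \<omega>" "\<omega> \<subseteq> - \<Lambda>"
      using \<xi>(1) by (auto simp: \<omega>_def space_\<mu> locally_finite_def Diff_Int_distrib2)
    have good_conf: "\<forall>y. reduced_intensity \<Phi> y (\<eta> \<union> \<omega>) \<le> ennreal C"
      if "finite \<eta>" "\<eta> \<subseteq> \<Lambda>" "\<eta> \<union> \<omega> \<notin> N' m" "card \<eta> \<le> m" for \<eta> m
    proof -
      have "(\<eta> \<union> \<omega>) \<inter> \<Lambda> = \<eta>"
        using that \<omega> by auto
      then have "\<eta> \<union> \<omega> \<notin> N"
        using that locally_finite_Un_finite[OF \<omega>(1)] by (auto simp: N'_def)
      then show ?thesis
        using N(2) that locally_finite_Un_finite[OF \<omega>(1)] by (auto simp: space_\<mu>)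
    qed
    have 0: "gibbs_weight \<Phi> \<Lambda> \<omega> (N' m) = 0" for m
      using \<xi> by (simp add: \<omega>_def)
    show "good \<Lambda> (\<xi> - \<Lambda>)"
      unfolding good_def \<omega>_def[symmetric]
    proof
      fix k :: nat
      show "AE x in \<Pi>\<^sub>M i\<in>{..<k}. lborel. x \<in> {..<k} \<rightarrow>\<^sub>E \<Lambda> \<longrightarrow> boltzmann \<Phi> \<omega> (x ` {..<k}) \<noteq> 0 \<longrightarrow>
        (\<forall>y. reduced_intensity \<Phi> y (x ` {..<k} \<union> \<omega>) \<le> ennreal C)"
      proof (cases k)
        \<comment> \<open>With no points the weight has no integral; its indicator term alone shows
          that \<open>\<omega>\<close> avoids the exceptional set.\<close>
        case 0
        have "\<omega> \<notin> N' 0"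
          using \<open>gibbs_weight \<Phi> \<Lambda> \<omega> (N' 0) = 0\<close> by (auto simp: gibbs_weight_eq indicator_def split: if_splits)
        then show ?thesis
          using good_conf[of "{}" 0] 0 by simp
      next
        case (Suc j)
        have "gibbs_term \<Phi> \<Lambda> \<omega> (N' k) (Suc j) / ennreal (fact (Suc j)) = 0"
          using 0[of k] by (simp add: gibbs_weight_eq suminf_eq_zero_iff)
        then have "gibbs_term \<Phi> \<Lambda> \<omega> (N' k) k = 0"
          by (simp add: Suc)
        then have "AE x in \<Pi>\<^sub>M i\<in>{..<k}. lborel.
            indicator (N' k) (x ` {..<k} \<union> \<omega>) * boltzmann \<Phi> \<omega> (x ` {..<k}) * indicator ({..<k} \<rightarrow>\<^sub>E \<Lambda>) x = 0"
          unfolding gibbs_term_def using N' sets_\<mu>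
          by (subst (asm) nn_integral_0_iff_AE) (auto intro!: measurable_gibbs_integrand wd \<Lambda> \<omega>)
        then show ?thesis
        proof (rule eventually_mono, intro impI)
          fix x :: "nat \<Rightarrow> 'a"
          assume x: "indicator (N' k) (x ` {..<k} \<union> \<omega>) * boltzmann \<Phi> \<omega> (x ` {..<k}) * indicator ({..<k} \<rightarrow>\<^sub>E \<Lambda>) x = 0"
            "x \<in> {..<k} \<rightarrow>\<^sub>E \<Lambda>" "boltzmann \<Phi> \<omega> (x ` {..<k}) \<noteq> 0"
          show "\<forall>y. reduced_intensity \<Phi> y (x ` {..<k} \<union> \<omega>) \<le> ennreal C"
            using x card_image_le[of "{..<k}" x] by (intro good_conf[of _ k]) (auto split: split_indicator_asm)
        qed
      qed
    qed
  qed
qed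

text \<open>Each new point contributes a factor at most \<open>exp (- \<phi>) * C\<close>, by
  stability given the points already placed. The exponent is the number of distinct entries because
  configurations are sets.\<close>

lemma AE_boltzmann_le:
  assumes \<omega>: "locally_finite \<omega>" "\<omega> \<subseteq> - \<Lambda>" "good \<Lambda> \<omega>"
  shows "AE x in \<Pi>\<^sub>M i\<in>{..<k::nat}. lborel. x \<in> {..<k} \<rightarrow>\<^sub>E \<Lambda> \<longrightarrow>
    boltzmann \<Phi> \<omega> (x ` {..<k}) \<le> ennreal ((exp (- \<phi>) * C) ^ card (x ` {..<k}))"
proof (induction k)
  case 0
  then show ?case
    by (simp add: boltzmann_empty)
next
  case (Suc k)
  interpret product_sigma_finite "\<lambda>_. lborel :: 'a measure"
    by standard
  let ?P = "\<lambda>x. x \<in> {..<k} \<rightarrow>\<^sub>E \<Lambda> \<longrightarrow>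
      boltzmann \<Phi> \<omega> (x ` {..<k}) \<le> ennreal ((exp (- \<phi>) * C) ^ card (x ` {..<k})) \<and>
      (boltzmann \<Phi> \<omega> (x ` {..<k}) \<noteq> 0 \<longrightarrow> (\<forall>y. reduced_intensity \<Phi> y (x ` {..<k} \<union> \<omega>) \<le> ennreal C))"
  have "AE x in \<Pi>\<^sub>M i\<in>{..<k}. lborel. ?P x"
    using Suc.IH \<omega>(3)[unfolded good_def, rule_format, of k] by eventually_elim blast
  then have "AE x in \<Pi>\<^sub>M i\<in>insert k {..<k}. lborel. ?P (restrict x {..<k})"
    by (intro AE_PiM_restrict) auto
  then show ?case
    unfolding lessThan_Suc
  proof (rule eventually_mono, intro impI)
    fix x :: "nat \<Rightarrow> 'a"
    assume P: "?P (restrict x {..<k})" and x: "x \<in> insert k {..<k} \<rightarrow>\<^sub>E \<Lambda>"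
    define \<xi> where "\<xi> = x ` {..<k}"
    have "restrict x {..<k} \<in> {..<k} \<rightarrow>\<^sub>E \<Lambda>"
      using x by auto
    with P have le: "boltzmann \<Phi> \<omega> \<xi> \<le> ennreal ((exp (- \<phi>) * C) ^ card \<xi>)"
      and red: "boltzmann \<Phi> \<omega> \<xi> \<noteq> 0 \<Longrightarrow> reduced_intensity \<Phi> (x k) (\<xi> \<union> \<omega>) \<le> ennreal C"
      by (auto simp: \<xi>_def)
    have "boltzmann \<Phi> \<omega> (insert (x k) \<xi>) \<le> ennreal ((exp (- \<phi>) * C) ^ card (insert (x k) \<xi>))"
    proof (cases "x k \<in> \<xi>")
      case True \<comment> \<open>The integrals include vectors with repeated entries.\<close>
      then show ?thesis
        using le by (simp add: insert_absorb)
    next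
      case False
      have "boltzmann \<Phi> \<omega> (insert (x k) \<xi>) =
          ennreal (exp (- \<phi>)) * reduced_intensity \<Phi> (x k) (\<xi> \<union> \<omega>) * boltzmann \<Phi> \<omega> \<xi>"
        using x \<omega> False by (intro boltzmann_insert wd \<phi>) (auto simp: \<xi>_def)
      \<comment> \<open>If the old factor is 0, both sides need no information on the intensity,
        since 0 absorbs even \<infinity> in \<open>ennreal\<close>.\<close>
      also have "\<dots> \<le> ennreal (exp (- \<phi>)) * ennreal C * ennreal ((exp (- \<phi>) * C) ^ card \<xi>)"
        using le red by (cases "boltzmann \<Phi> \<omega> \<xi> = 0") (auto intro!: mult_mono)
      also have "\<dots> = ennreal ((exp (- \<phi>) * C) ^ card (insert (x k) \<xi>))"
        using C(1) False by (simp add: \<xi>_def flip: ennreal_mult)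
      finally show ?thesis .
    qed
    then show "boltzmann \<Phi> \<omega> (x ` insert k {..<k}) \<le> ennreal ((exp (- \<phi>) * C) ^ card (x ` insert k {..<k}))"
      by (simp add: \<xi>_def)
  qed
qed

text \<open>Lowering the activity turns \<open>exp (- \<phi>) * C\<close> per point into
  \<open>\<beta> * C\<close>. As \<open>k > 0\<close> there is at least one point, so one such
  factor remains when the others are bounded by 1.\<close>

lemma AE_boltzmann_\<Psi>_le:
  fixes k :: nat
  assumes \<omega>: "locally_finite \<omega>" "\<omega> \<subseteq> - \<Lambda>" "good \<Lambda> \<omega>" and k: "0 < k"
  shows "AE x in \<Pi>\<^sub>M i\<in>{..<k}. lborel. x \<in> {..<k} \<rightarrow>\<^sub>E \<Lambda> \<longrightarrow> boltzmann \<Psi> \<omega> (x ` {..<k}) \<le> ennreal (\<beta> * C)"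
  using AE_boltzmann_le[OF \<omega>, of k]
proof (rule eventually_mono, intro impI)
  fix x
  assume x: "x \<in> {..<k} \<rightarrow>\<^sub>E \<Lambda>"
    "x \<in> {..<k} \<rightarrow>\<^sub>E \<Lambda> \<longrightarrow> boltzmann \<Phi> \<omega> (x ` {..<k}) \<le> ennreal ((exp (- \<phi>) * C) ^ card (x ` {..<k}))"
  have "boltzmann \<Psi> \<omega> (x ` {..<k}) = ennreal (ratio ^ card (x ` {..<k})) * boltzmann \<Phi> \<omega> (x ` {..<k})"
    using x(1) \<omega> by (intro boltzmann_\<Psi>) auto
  also have "\<dots> \<le> ennreal (ratio ^ card (x ` {..<k})) * ennreal ((exp (- \<phi>) * C) ^ card (x ` {..<k}))"
    using x by (intro mult_left_mono) auto
  also have "\<dots> = ennreal ((ratio * (exp (- \<phi>) * C)) ^ card (x ` {..<k}))"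
    using C(1) ratio(1) by (subst ennreal_mult[symmetric]) (simp_all only: power_mult_distrib, simp_all)
  also have "ratio * (exp (- \<phi>) * C) = \<beta> * C"
    by simp
  also have "(\<beta> * C) ^ card (x ` {..<k}) \<le> (\<beta> * C) ^ 1"
    using C \<beta> k by (intro power_decreasing) (auto simp: Suc_le_eq card_gt_0_iff)
  finally show "boltzmann \<Psi> \<omega> (x ` {..<k}) \<le> ennreal (\<beta> * C)"
    by (simp add: ennreal_leI)
qed

section \<open>Resampling estimates\<close>

text \<open>The empty filling drops out since \<open>\<omega> \<notin> A\<close>, and the rest is
  dominated by the exponential series without its first term. The number \<open>b\<close> stands for
  what the event demands outside \<open>\<Lambda>\<close>.\<close>

lemma gibbs_kernel_le:
  assumes \<Lambda>: "bounded \<Lambda>" "\<Lambda> \<in> sets borel" "emeasure lborel \<Lambda> \<le> ennreal L"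
    and \<omega>: "locally_finite \<omega>" "\<omega> \<subseteq> - \<Lambda>" "good \<Lambda> \<omega>"
    and A: "\<omega> \<notin> A" and b: "\<And>\<eta>. \<eta> \<subseteq> \<Lambda> \<Longrightarrow> indicator A (\<eta> \<union> \<omega>) \<le> (b :: ennreal)"
  shows "gibbs_kernel \<Psi> \<Lambda> \<omega> A \<le> ennreal (\<beta> * C * exp L) * b"
proof -
  interpret product_sigma_finite "\<lambda>_. lborel :: 'a measure"
    by standard
  obtain l where l: "0 \<le> l" "emeasure lborel \<Lambda> = ennreal l"
    using \<Lambda>(3) by (cases "emeasure lborel \<Lambda>") (auto simp: top_unique)
  \<comment> \<open>A negative \<open>L\<close> is read as 0 by \<open>ennreal\<close>, which forces
    volume 0.\<close>
  have lL: "l \<le> L \<or> l = 0"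
    using \<Lambda>(3) l by (cases "0 \<le> L") (auto simp: ennreal_neg)
  have "gibbs_term \<Psi> \<Lambda> \<omega> A (Suc j) \<le> ennreal (\<beta> * C * l ^ Suc j) * b" for j
  proof -
    have "gibbs_term \<Psi> \<Lambda> \<omega> A (Suc j) \<le>
        (\<integral>\<^sup>+x. (b * ennreal (\<beta> * C)) * indicator ({..<Suc j} \<rightarrow>\<^sub>E \<Lambda>) x \<partial>(\<Pi>\<^sub>M i\<in>{..<Suc j}. lborel))"
      unfolding gibbs_term_def
    proof (rule nn_integral_mono_AE)
      show "AE x in \<Pi>\<^sub>M i\<in>{..<Suc j}. lborel.
          indicator A (x ` {..<Suc j} \<union> \<omega>) * boltzmann \<Psi> \<omega> (x ` {..<Suc j}) * indicator ({..<Suc j} \<rightarrow>\<^sub>E \<Lambda>) x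
          \<le> b * ennreal (\<beta> * C) * indicator ({..<Suc j} \<rightarrow>\<^sub>E \<Lambda>) x"
        using AE_boltzmann_\<Psi>_le[OF \<omega> zero_less_Suc[of j]]
      proof (rule eventually_mono)
        fix x :: "nat \<Rightarrow> 'a"
        assume *: "x \<in> {..<Suc j} \<rightarrow>\<^sub>E \<Lambda> \<longrightarrow> boltzmann \<Psi> \<omega> (x ` {..<Suc j}) \<le> ennreal (\<beta> * C)"
        show "indicator A (x ` {..<Suc j} \<union> \<omega>) * boltzmann \<Psi> \<omega> (x ` {..<Suc j}) * indicator ({..<Suc j} \<rightarrow>\<^sub>E \<Lambda>) x
          \<le> b * ennreal (\<beta> * C) * indicator ({..<Suc j} \<rightarrow>\<^sub>E \<Lambda>) x"
        proof (cases "x \<in> {..<Suc j} \<rightarrow>\<^sub>E \<Lambda>")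
          case True
          then have "x ` {..<Suc j} \<subseteq> \<Lambda>"
            by auto
          with True * b show ?thesis
            by (auto intro!: mult_mono)
        qed simp
      qed
    qed
    also have "\<dots> = b * ennreal (\<beta> * C) * emeasure (\<Pi>\<^sub>M i\<in>{..<Suc j}. lborel) ({..<Suc j} \<rightarrow>\<^sub>E \<Lambda>)"
      using \<Lambda> by (intro nn_integral_cmult_indicator sets_PiM_I_finite) auto
    also have "emeasure (\<Pi>\<^sub>M i\<in>{..<Suc j}. lborel) ({..<Suc j} \<rightarrow>\<^sub>E \<Lambda>) = ennreal (l ^ Suc j)"
      using \<Lambda> l by (subst emeasure_PiM) (auto simp: ennreal_power ennreal_mult)
    finally show ?thesis
      using l C \<beta> by (simp add: ennreal_mult mult_ac)
  qed
  then have "gibbs_weight \<Psi> \<Lambda> \<omega> A \<le> (\<Sum>j. ennreal (\<beta> * C * l ^ Suc j) * b / ennreal (fact (Suc j)))"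
    unfolding gibbs_weight_eq using A
    by (auto intro!: suminf_le divide_right_mono_ennreal)
  also have "\<dots> = (\<Sum>j. ennreal (\<beta> * C * (l ^ Suc j / fact (Suc j))) * b)"
  proof (intro suminf_cong)
    fix j
    have "ennreal (\<beta> * C * l ^ Suc j) / ennreal (fact (Suc j)) = ennreal (\<beta> * C * l ^ Suc j / fact (Suc j))"
      using l C \<beta> by (intro divide_ennreal) auto
    then show "ennreal (\<beta> * C * l ^ Suc j) * b / ennreal (fact (Suc j)) =
        ennreal (\<beta> * C * (l ^ Suc j / fact (Suc j))) * b"
      by (metis ennreal_times_divide mult.commute times_divide_eq_right)
  qed
  also have "\<dots> = ennreal (\<beta> * C * (exp l - 1)) * b"
  proof -
    have "(\<lambda>j. l ^ Suc j / fact (Suc j)) sums (exp l - 1)"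
      using exp_converges[of l] by (subst sums_Suc_iff) (simp add: divide_inverse mult.commute)
    then have "(\<Sum>j. ennreal (\<beta> * C * (l ^ Suc j / fact (Suc j)))) = ennreal (\<beta> * C * (exp l - 1))"
      using l C \<beta> by (intro suminf_ennreal_eq sums_mult) auto
    then show ?thesis
      by (simp only: ennreal_suminf_multc)
  qed
  also have "\<dots> \<le> ennreal (\<beta> * C * exp L) * b"
  proof -
    have "exp l - 1 \<le> exp L"
      using lL by (smt (verit) exp_le_cancel_iff exp_gt_zero exp_zero)
    then show ?thesis
      using C \<beta> by (intro mult_right_mono ennreal_leI mult_left_mono) auto
  qed
  finally have "gibbs_weight \<Psi> \<Lambda> \<omega> A \<le> ennreal (\<beta> * C * exp L) * b" .
  have "gibbs_kernel \<Psi> \<Lambda> \<omega> A \<le> gibbs_weight \<Psi> \<Lambda> \<omega> A / 1"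
    unfolding gibbs_kernel_def divide_ennreal_def
    by (intro mult_left_mono ennreal_inverse_antimono partition_function_ge_1) auto
  then have "gibbs_kernel \<Psi> \<Lambda> \<omega> A \<le> gibbs_weight \<Psi> \<Lambda> \<omega> A"
    by (simp add: divide_ennreal_def)
  also note \<open>gibbs_weight \<Psi> \<Lambda> \<omega> A \<le> ennreal (\<beta> * C * exp L) * b\<close>
  finally show ?thesis
    .
qed

text \<open>Resampling \<open>\<Lambda> i\<close> leaves the other sets untouched by disjointness,
  so \<open>b\<close> is the indicator of the event for \<open>I\<close>. The condition
  \<open>\<omega> \<notin> A\<close> holds because \<open>\<xi> - \<Lambda> i\<close> does not meet
  \<open>\<Lambda> i\<close>.\<close>

lemma emeasure_meets_all_le:
  assumes "finite I" "disjoint_family_on \<Lambda> I"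
    and "\<And>i. i \<in> I \<Longrightarrow> bounded (\<Lambda> i)" "\<And>i. i \<in> I \<Longrightarrow> \<Lambda> i \<in> sets borel"
    and "\<And>i. i \<in> I \<Longrightarrow> emeasure lborel (\<Lambda> i) \<le> ennreal L"
  shows "emeasure \<mu> {\<xi>. locally_finite \<xi> \<and> (\<forall>i\<in>I. \<xi> \<inter> \<Lambda> i \<noteq> {})} \<le> ennreal (\<beta> * C * exp L) ^ card I"
  using assms
proof (induction I)
  case empty
  interpret prob_space \<mu>
    using gibbs by (simp add: gibbs_measures_def)
  show ?case
    using emeasure_space_1 by (simp add: space_\<mu>)
next
  case (insert i I)
  let ?E = "\<lambda>I. {\<xi>. locally_finite \<xi> \<and> (\<forall>i\<in>I. \<xi> \<inter> \<Lambda> i \<noteq> {})}"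
  have IH: "emeasure \<mu> (?E I) \<le> ennreal (\<beta> * C * exp L) ^ card I"
    using insert by (intro insert.IH) (auto simp: disjoint_family_on_def)
  have sets: "?E (insert i I) \<in> sets conf_space" "?E I \<in> sets conf_space"
    using insert by (intro sets_conf_space_meets_all; auto)+
  have \<Lambda>: "bounded (\<Lambda> i)" "\<Lambda> i \<in> sets borel" "emeasure lborel (\<Lambda> i) \<le> ennreal L"
    using insert by auto
  have disj: "\<Lambda> j \<inter> \<Lambda> i = {}" if "j \<in> I" for j
    using insert that by (auto simp: disjoint_family_on_def)
  have "emeasure \<mu> (?E (insert i I)) = (\<integral>\<^sup>+\<xi>. gibbs_kernel \<Psi> (\<Lambda> i) (\<xi> - \<Lambda> i) (?E (insert i I)) \<partial>\<mu>)"
    using sets \<Lambda> by (intro emeasure_\<mu>)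
  also have "\<dots> \<le> (\<integral>\<^sup>+\<xi>. ennreal (\<beta> * C * exp L) * indicator (?E I) \<xi> \<partial>\<mu>)"
  proof (rule nn_integral_mono_AE)
    show "AE \<xi> in \<mu>. gibbs_kernel \<Psi> (\<Lambda> i) (\<xi> - \<Lambda> i) (?E (insert i I)) \<le>
        ennreal (\<beta> * C * exp L) * indicator (?E I) \<xi>"
      using AE_good[OF \<Lambda>(1,2)]
    proof (rule AE_mp, intro AE_I2 impI gibbs_kernel_le[OF \<Lambda>])
      fix \<xi> assume \<xi>: "\<xi> \<in> space \<mu>"
      show "locally_finite (\<xi> - \<Lambda> i)"
        using \<xi> by (auto simp: space_\<mu> locally_finite_def Diff_Int_distrib2)
      fix \<eta> assume \<eta>: "\<eta> \<subseteq> \<Lambda> i"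
      have "\<xi> \<inter> \<Lambda> j = (\<eta> \<union> (\<xi> - \<Lambda> i)) \<inter> \<Lambda> j" if "j \<in> I" for j
        using disj[OF that] \<eta> by auto
      then show "indicator (?E (insert i I)) (\<eta> \<union> (\<xi> - \<Lambda> i)) \<le> (indicator (?E I) \<xi> :: ennreal)"
        using \<xi> by (auto simp: space_\<mu> indicator_def)
    qed auto
  qed
  also have "\<dots> = ennreal (\<beta> * C * exp L) * emeasure \<mu> (?E I)"
    using sets sets_\<mu> by (intro nn_integral_cmult_indicator) auto
  also have "\<dots> \<le> ennreal (\<beta> * C * exp L) * ennreal (\<beta> * C * exp L) ^ card I"
    by (intro mult_left_mono IH) auto
  finally show ?case
    using insert by simp
qed

end

section \<open>Lattice cells and lattice paths\<close>

text \<open>For \<open>s > 0\<close> this is the lower corner, in units of \<open>s\<close>, of the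
  half-open cube of side \<open>s\<close> containing \<open>x\<close>. A \<open>z\<close> with a
  non-integer coordinate has an empty cell, so cells may be indexed by all vectors.\<close>

definition lattice_point :: "real \<Rightarrow> 'a::euclidean_space \<Rightarrow> 'a" where
  "lattice_point s x = (\<Sum>b\<in>Basis. of_int \<lfloor>x \<bullet> b / s\<rfloor> *\<^sub>R b)"

definition lattice_cell :: "real \<Rightarrow> 'a::euclidean_space \<Rightarrow> 'a set" where
  "lattice_cell s z = {x. lattice_point s x = z}"

text \<open>Diagonal neighbours are included, and so is 0, as two nearby points may share a
  cell.\<close>

definition unit_steps :: "'a::euclidean_space set" where
  "unit_steps = (\<lambda>f. \<Sum>b\<in>Basis. of_int (f b) *\<^sub>R b) ` (Basis \<rightarrow>\<^sub>E {-1, 0, 1 :: int})"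

lemma lattice_point_inner: "b \<in> Basis \<Longrightarrow> lattice_point s x \<bullet> b = of_int \<lfloor>x \<bullet> b / s\<rfloor>"
  by (simp add: lattice_point_def)

lemma finite_unit_steps: "finite unit_steps"
  by (simp add: unit_steps_def finite_PiE)

lemma countable_range_lattice_point: "countable (range (lattice_point s :: 'a::euclidean_space \<Rightarrow> 'a))"
proof -
  have "range (lattice_point s) \<subseteq>
      (\<lambda>f. \<Sum>b\<in>Basis. of_int (f b) *\<^sub>R b) ` (Basis \<rightarrow>\<^sub>E (UNIV :: int set) :: ('a \<Rightarrow> int) set)"
  proof (rule image_subsetI)
    fix x :: 'a
    show "lattice_point s x \<in> (\<lambda>f. \<Sum>b\<in>Basis. of_int (f b) *\<^sub>R b) ` (Basis \<rightarrow>\<^sub>E (UNIV :: int set))"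
    proof (rule image_eqI)
      show "lattice_point s x = (\<Sum>b\<in>Basis. of_int ((\<lambda>b\<in>Basis. \<lfloor>x \<bullet> b / s\<rfloor>) b) *\<^sub>R b)"
        unfolding lattice_point_def by (rule sum.cong) simp_all
    qed (intro PiE_I, simp_all)
  qed
  moreover have "countable (Basis \<rightarrow>\<^sub>E (UNIV :: int set) :: ('a \<Rightarrow> int) set)"
    by (intro countable_PiE) auto
  ultimately show ?thesis
    by (meson countable_image countable_subset)
qed

text \<open>Scaled coordinates differ by less than 1, so their floors differ by at most 1. This
  fixes the side length as the distance bound for intersecting balls.\<close>

lemma lattice_point_diff:
  assumes "dist x y < s"
  shows "lattice_point s y - lattice_point s x \<in> unit_steps"
proof -
  let ?f = "\<lambda>b\<in>Basis. \<lfloor>y \<bullet> b / s\<rfloor> - \<lfloor>x \<bullet> b / s\<rfloor>"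
  have "\<lfloor>y \<bullet> b / s\<rfloor> - \<lfloor>x \<bullet> b / s\<rfloor> \<in> {-1, 0, 1}" if "b \<in> Basis" for b
  proof -
    have s: "0 < s"
      using assms zero_le_dist[of x y] by linarith
    have "\<bar>(y - x) \<bullet> b\<bar> < s"
      using Basis_le_norm[OF that, of "y - x"] assms by (simp add: dist_norm norm_minus_commute)
    then have "\<bar>y \<bullet> b / s - x \<bullet> b / s\<bar> < 1"
      using s by (simp add: abs_divide inner_diff_left flip: diff_divide_distrib)
    then have "\<lfloor>y \<bullet> b / s\<rfloor> - \<lfloor>x \<bullet> b / s\<rfloor> \<le> 1 \<and> -1 \<le> \<lfloor>y \<bullet> b / s\<rfloor> - \<lfloor>x \<bullet> b / s\<rfloor>"
      by linarith
    then show ?thesis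
      by auto
  qed
  then have "?f \<in> Basis \<rightarrow>\<^sub>E {-1, 0, 1}"
    by (intro PiE_I) simp_all
  moreover have "lattice_point s y - lattice_point s x = (\<Sum>b\<in>Basis. of_int (?f b) *\<^sub>R b)"
    by (simp add: lattice_point_def scaleR_diff_left sum_subtractf)
  ultimately show ?thesis
    unfolding unit_steps_def by blast
qed

lemma disjoint_lattice_cell: "disjoint_family_on (lattice_cell s) I"
  by (auto simp: disjoint_family_on_def lattice_cell_def)

lemma sets_lattice_cell: "lattice_cell s z \<in> sets borel"
proof -
  have "lattice_point s \<in> borel_measurable borel"
    unfolding lattice_point_def by measurable
  from measurable_sets[OF this, of "{z}"] show ?thesis
    by (simp add: lattice_cell_def vimage_def)
qed

lemma lattice_cell_subset:
  assumes "0 < s"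
  shows "lattice_cell s z \<subseteq> cbox (s *\<^sub>R z) (s *\<^sub>R (z + One))"
proof
  fix x assume x: "x \<in> lattice_cell s z"
  have "s * (z \<bullet> b) \<le> x \<bullet> b \<and> x \<bullet> b \<le> s * (z \<bullet> b + 1)" if b: "b \<in> Basis" for b
  proof -
    have "z \<bullet> b = of_int \<lfloor>x \<bullet> b / s\<rfloor>"
      using x lattice_point_inner[OF b, of s x] by (simp add: lattice_cell_def)
    then have "z \<bullet> b \<le> x \<bullet> b / s \<and> x \<bullet> b / s \<le> z \<bullet> b + 1"
      by linarith
    then show ?thesis
      using assms by (simp add: field_simps)
  qed
  then show "x \<in> cbox (s *\<^sub>R z) (s *\<^sub>R (z + One))"
    by (auto simp: mem_box inner_add_left)
qed

lemma bounded_lattice_cell: "0 < s \<Longrightarrow> bounded (lattice_cell s z)"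
  by (rule bounded_subset[OF bounded_cbox lattice_cell_subset])

lemma emeasure_lattice_cell_le:
  fixes z :: "'a::euclidean_space"
  assumes "0 < s"
  shows "emeasure lborel (lattice_cell s z) \<le> ennreal (s ^ DIM('a))"
proof -
  have "emeasure lborel (lattice_cell s z) \<le> emeasure lborel (cbox (s *\<^sub>R z) (s *\<^sub>R (z + One)))"
    using assms by (intro emeasure_mono lattice_cell_subset) auto
  also have "\<dots> = ennreal (s ^ DIM('a))"
    using assms by (subst emeasure_lborel_cbox) (auto simp: inner_add_left algebra_simps)
  finally show ?thesis .
qed

text \<open>Paths are stored in reverse order.\<close>

primrec lattice_paths :: "'a::euclidean_space \<Rightarrow> nat \<Rightarrow> 'a list set" where
  "lattice_paths z 0 = {[z]}"
| "lattice_paths z (Suc n) = (\<lambda>(v, p). (hd p + v) # p) ` (unit_steps \<times> lattice_paths z n)"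

lemma finite_lattice_paths: "finite (lattice_paths z n)"
  by (induction n) (auto simp: finite_unit_steps)

lemma card_lattice_paths:
  "card (lattice_paths (z :: 'a::euclidean_space) n) \<le> card (unit_steps :: 'a set) ^ n"
proof (induction n)
  case (Suc n)
  have "card (lattice_paths z (Suc n)) \<le> card ((unit_steps :: 'a set) \<times> lattice_paths z n)"
    unfolding lattice_paths.simps by (intro card_image_le) (simp add: finite_unit_steps finite_lattice_paths)
  also have "\<dots> \<le> card (unit_steps :: 'a set) * card (unit_steps :: 'a set) ^ n"
    using Suc by (simp add: card_cartesian_product)
  finally show ?case
    by simp
qed simp

lemma length_lattice_paths: "p \<in> lattice_paths z n \<Longrightarrow> length p = Suc n"
  by (induction n arbitrary: p) auto

lemma rev_map_in_lattice_paths: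
  "(\<And>i. i < n \<Longrightarrow> f (Suc i) - f i \<in> unit_steps) \<Longrightarrow> rev (map f [0..<Suc n]) \<in> lattice_paths (f 0) n"
proof (induction n)
  case (Suc n)
  then have "rev (map f [0..<Suc n]) \<in> lattice_paths (f 0) n"
    by simp
  moreover have "rev (map f [0..<Suc (Suc n)]) =
      (hd (rev (map f [0..<Suc n])) + (f (Suc n) - f n)) # rev (map f [0..<Suc n])"
    by simp
  moreover have "f (Suc n) - f n \<in> unit_steps"
    using Suc.prems by simp
  ultimately show ?case
    unfolding lattice_paths.simps by (intro image_eqI[of _ _ "(f (Suc n) - f n, rev (map f [0..<Suc n]))"]) auto
qed simp

section \<open>Unbounded clusters\<close>

definition occupied :: "real \<Rightarrow> 'a::euclidean_space set \<Rightarrow> 'a \<Rightarrow> bool" where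
  "occupied s \<xi> z \<longleftrightarrow> \<xi> \<inter> lattice_cell s z \<noteq> {}"

text \<open>A repeated vertex would allow the loop between its two visits to be cut out, giving a
  shorter walk.\<close>

lemma relpow_least_inj:
  assumes f: "\<And>i. i < m \<Longrightarrow> (f i, f (Suc i)) \<in> Q"
    and least: "\<And>k. (f 0, f m) \<in> Q ^^ k \<Longrightarrow> m \<le> k"
  shows "inj_on f {..m}"
proof (rule linorder_inj_onI)
  have walk: "(f i, f j) \<in> Q ^^ (j - i)" if "i \<le> j" "j \<le> m" for i j
    unfolding relpow_fun_conv using that f by (intro exI[of _ "\<lambda>k. f (i + k)"]) auto
  fix i j assume ij: "i < j" "i \<in> {..m}" "j \<in> {..m}"
  show "f i \<noteq> f j"
  proof
    assume "f i = f j"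
    then have "(f 0, f m) \<in> Q ^^ (i + (m - j))"
      using relcompI[of "f 0" "f i" "Q ^^ i" "f m" "Q ^^ (m - j)"] walk[of 0 i] walk[of j m] ij
      by (simp only: relpow_add) simp
    then have "m \<le> i + (m - j)"
      by (rule least)
    with ij show False
      by simp
  qed
qed auto

text \<open>The points of a cluster form a single class of the relation of having distance less than
  \<open>2 * R\<close>, since the balls around a class are disjoint from the remaining balls.\<close>

lemma unbounded_component_chain:
  assumes R: "0 < R" and C: "C \<in> components (boolean_model R \<xi>)" "\<not> bounded C"
  obtains x0 where "x0 \<in> \<xi>" "\<not> bounded ({(x, y). x \<in> \<xi> \<and> y \<in> \<xi> \<and> dist x y < 2 * R}\<^sup>* `` {x0})"
proof -
  define r where "r = {(x, y). x \<in> \<xi> \<and> y \<in> \<xi> \<and> dist x y < 2 * R}"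
  obtain c where "c \<in> C"
    using in_components_nonempty[OF C(1)] by auto
  moreover then have "c \<in> boolean_model R \<xi>"
    using in_components_subset[OF C(1)] by auto
  ultimately obtain x0 where c: "c \<in> C" "x0 \<in> \<xi>" "c \<in> ball x0 R"
    by (auto simp: boolean_model_def)
  define K where "K = r\<^sup>* `` {x0}"
  define U V where "U = (\<Union>x\<in>K. ball x R)" and "V = (\<Union>x\<in>\<xi> - K. ball x R)"
  have "U \<inter> V = {}"
  proof (rule ccontr)
    assume "U \<inter> V \<noteq> {}"
    then obtain u where "u \<in> U" "u \<in> V"
      by blast
    then obtain x y where u: "x \<in> K" "y \<in> \<xi> - K" "dist x u < R" "dist y u < R"
      unfolding U_def V_def UN_iff mem_ball by blast
    have "x \<in> \<xi>"
      using u(1) c(2) by (auto simp: K_def r_def elim: rtranclE)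
    moreover have "dist x y < 2 * R"
      using dist_triangle2[of x y u] u by linarith
    ultimately have "(x, y) \<in> r"
      using u by (auto simp: r_def)
    with u show False
      by (auto simp: K_def intro: rtrancl_into_rtrancl)
  qed
  moreover have "C \<subseteq> U \<union> V"
    using in_components_subset[OF C(1)] by (auto simp: boolean_model_def U_def V_def)
  moreover have "c \<in> U \<inter> C"
    using c by (auto simp: U_def K_def)
  moreover have "open U" "open V"
    by (auto simp: U_def V_def)
  ultimately have "V \<inter> C = {}"
    using connectedD[OF in_components_connected[OF C(1)], of U V] by blast
  with \<open>C \<subseteq> U \<union> V\<close> have "C \<subseteq> U"
    by auto
  \<comment> \<open>Every point of \<open>U\<close> is within \<open>R\<close> of \<open>K\<close>,
    so a bounded class would give a bounded component.\<close>
  have "\<not> bounded K"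
  proof
    assume "bounded K"
    then obtain B where B: "\<And>x. x \<in> K \<Longrightarrow> norm x \<le> B"
      by (auto simp: bounded_iff)
    have "norm u \<le> B + R" if "u \<in> U" for u
    proof -
      obtain x where x: "x \<in> K" "dist x u < R"
        using \<open>u \<in> U\<close> by (auto simp: U_def)
      then show ?thesis
        using B[OF x(1)] norm_triangle_sub[of u x] by (simp add: dist_norm norm_minus_commute)
    qed
    then have "bounded U"
      by (auto simp: bounded_iff)
    with \<open>C \<subseteq> U\<close> C(2) show False
      by (meson bounded_subset)
  qed
  with c(2) show thesis
    by (intro that) (auto simp: K_def r_def)
qed

text \<open>A shortest walk to the cell of a far point of the class is self-avoiding, and so are its
  initial segments. The starting cell is chosen before \<open>n\<close>, so only countably many
  events arise.\<close>

lemma unbounded_component_path: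
  fixes \<xi> :: "'a::euclidean_space set"
  assumes R: "0 < R" and C: "C \<in> components (boolean_model R \<xi>)" "\<not> bounded C"
  shows "\<exists>z\<in>range (lattice_point (2 * R)). \<forall>n. \<exists>p\<in>lattice_paths z n. distinct p \<and> (\<forall>y\<in>set p. occupied (2 * R) \<xi> y)"
proof -
  define r where "r = {(x, y). x \<in> \<xi> \<and> y \<in> \<xi> \<and> dist x y < 2 * R}"
  obtain x0 where x0: "x0 \<in> \<xi>" "\<not> bounded (r\<^sup>* `` {x0})"
    using unbounded_component_chain[OF R C] unfolding r_def by blast
  let ?L = "lattice_point (2 * R) :: 'a \<Rightarrow> 'a"
  \<comment> \<open>Only the target of a step must be occupied; the starting cell is occupied
    because it contains \<open>x0\<close>.\<close>
  define Q where "Q = {(z, z'). z' - z \<in> unit_steps \<and> occupied (2 * R) \<xi> z'}"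
  have walk: "(?L x0, ?L x) \<in> Q\<^sup>*" if "(x0, x) \<in> r\<^sup>*" for x
    using that
  proof induction
    case (step x y)
    then have "?L y - ?L x \<in> unit_steps" "occupied (2 * R) \<xi> (?L y)"
      by (auto simp: r_def lattice_point_diff occupied_def lattice_cell_def)
    then have "(?L x, ?L y) \<in> Q"
      by (simp add: Q_def)
    with step.IH show ?case
      by (rule rtrancl_into_rtrancl)
  qed simp
  have "\<exists>p\<in>lattice_paths (?L x0) n. distinct p \<and> (\<forall>y\<in>set p. occupied (2 * R) \<xi> y)" for n
  proof -
    \<comment> \<open>The finitely many cells reachable in at most \<open>n\<close> steps cover a
      bounded region, so the unbounded class has a point beyond it, and a walk to that point cannot
      be shorter than \<open>n\<close>.\<close>
    define W where "W = (\<Union>m\<le>n. hd ` lattice_paths (?L x0) m)"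
    have "finite W"
      by (simp add: W_def finite_lattice_paths)
    then have "bounded (\<Union>z\<in>W. lattice_cell (2 * R) z)"
      using R by (intro bounded_UN) (auto intro: bounded_lattice_cell)
    with x0(2) obtain x where x: "(x0, x) \<in> r\<^sup>*" "x \<notin> (\<Union>z\<in>W. lattice_cell (2 * R) z)"
      by (meson Image_singleton_iff bounded_subset subsetI)
    then have "?L x \<notin> W"
      by (auto simp: lattice_cell_def)
    define m where "m = (LEAST m. (?L x0, ?L x) \<in> Q ^^ m)"
    have "(?L x0, ?L x) \<in> Q ^^ m"
      using walk[OF x(1)] unfolding m_def rtrancl_power by (rule LeastI_ex)
    then obtain f where f: "f 0 = ?L x0" "f m = ?L x" "\<And>i. i < m \<Longrightarrow> (f i, f (Suc i)) \<in> Q"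
      unfolding relpow_fun_conv by blast
    have inj: "inj_on f {..m}"
    proof (rule relpow_least_inj[of m f Q])
      show "m \<le> k" if "(f 0, f m) \<in> Q ^^ k" for k
        using that unfolding f(1,2) by (subst m_def) (rule Least_le)
    qed (rule f(3))
    have path: "rev (map f [0..<Suc k]) \<in> lattice_paths (?L x0) k" if "k \<le> m" for k
      using rev_map_in_lattice_paths[of k f] f that by (auto simp: Q_def)
    have "n \<le> m"
    proof (rule ccontr)
      assume "\<not> n \<le> m"
      then have "hd (rev (map f [0..<Suc m])) \<in> W"
        using path[of m] unfolding W_def by (intro UN_I[of m] imageI) auto
      then show False
        using \<open>?L x \<notin> W\<close> f(2) by simp
    qed
    have "occupied (2 * R) \<xi> (f i)" if "i \<le> n" for i
    proof (cases i)
      case 0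
      then show ?thesis
        using x0(1) by (auto simp: f(1) occupied_def lattice_cell_def)
    next
      case (Suc j)
      then show ?thesis
        using f(3)[of j] that \<open>n \<le> m\<close> by (simp add: Q_def)
    qed
    moreover have "inj_on f {0..<Suc n}"
      using \<open>n \<le> m\<close> by (intro inj_on_subset[OF inj]) auto
    ultimately show ?thesis
      using path[OF \<open>n \<le> m\<close>] by (intro bexI[of _ "rev (map f [0..<Suc n])"]) (auto simp: distinct_map less_Suc_eq_le simp del: upt_Suc)
  qed
  then show ?thesis
    by blast
qed

text \<open>A first-moment argument: at most \<open>?M ^ n\<close> paths start at a given cell, each
  occupied with probability at most \<open>q ^ n\<close>. The percolation event only has to lie in a
  null set.\<close>

lemma AE_bounded_components:
  fixes \<mu> :: "'a::euclidean_space set measure" and q :: real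
  assumes sets: "sets \<mu> = sets conf_space" and R: "0 < R"
    and q: "0 \<le> q" "q \<le> 1" "q * card (unit_steps :: 'a set) < 1"
    and bound: "\<And>I. finite I \<Longrightarrow>
      emeasure \<mu> {\<xi>. locally_finite \<xi> \<and> (\<forall>z\<in>I. \<xi> \<inter> lattice_cell (2 * R) z \<noteq> {})} \<le> ennreal q ^ card I"
  shows "AE \<xi> in \<mu>. \<forall>C\<in>components (boolean_model R \<xi>). bounded C"
proof -
  let ?s = "2 * R"
  let ?M = "card (unit_steps :: 'a set)"
  let ?O = "\<lambda>I. {\<xi>. locally_finite \<xi> \<and> (\<forall>z\<in>I. \<xi> \<inter> lattice_cell ?s z \<noteq> {})}"
  have O_sets: "?O I \<in> sets \<mu>" if "finite I" for I
    unfolding sets using R that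
    by (intro sets_conf_space_meets_all) (auto intro: bounded_lattice_cell sets_lattice_cell)
  have "AE \<xi> in \<mu>. \<not> (\<forall>n. \<exists>p\<in>lattice_paths z n. distinct p \<and> (\<forall>y\<in>set p. occupied ?s \<xi> y))" for z :: 'a
  proof -
    define E where "E n = (\<Union>p\<in>{p \<in> lattice_paths z n. distinct p}. ?O (set p))" for n
    have fin: "finite {p \<in> lattice_paths z n. distinct p}" for n
      using finite_lattice_paths[of z n] by simp
    have E_sets: "E n \<in> sets \<mu>" for n
      unfolding E_def using fin O_sets by (intro sets.finite_UN) auto
    have E_le: "emeasure \<mu> (E n) \<le> ennreal ((q * ?M) ^ n)" for n
    proof -
      have "emeasure \<mu> (E n) \<le> (\<Sum>p\<in>{p \<in> lattice_paths z n. distinct p}. emeasure \<mu> (?O (set p)))"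
        unfolding E_def using fin O_sets by (intro emeasure_subadditive_finite) auto
      also have "\<dots> \<le> (\<Sum>p\<in>{p \<in> lattice_paths z n. distinct p}. ennreal (q ^ n))"
      proof (intro sum_mono)
        fix p assume p: "p \<in> {p \<in> lattice_paths z n. distinct p}"
        \<comment> \<open>A path of \<open>n\<close> steps has \<open>n + 1\<close> cells; the spare
          factor \<open>q \<le> 1\<close> is dropped next.\<close>
        then have "emeasure \<mu> (?O (set p)) \<le> ennreal (q ^ Suc n)"
          using bound[of "set p"] length_lattice_paths[of p z n] q(1)
          by (simp add: distinct_card ennreal_power del: power_Suc)
        also have "\<dots> \<le> ennreal (q ^ n)"
          using q by (intro ennreal_leI power_decreasing) auto
        finally show "emeasure \<mu> (?O (set p)) \<le> ennreal (q ^ n)" .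
      qed
      also have "\<dots> = ennreal (card {p \<in> lattice_paths z n. distinct p} * q ^ n)"
        using q by (simp add: ennreal_mult ennreal_of_nat_eq_real_of_nat)
      also have "\<dots> \<le> ennreal (?M ^ n * q ^ n)"
      proof (intro ennreal_leI mult_right_mono)
        have "card {p \<in> lattice_paths z n. distinct p} \<le> card (lattice_paths z n)"
          by (intro card_mono finite_lattice_paths) auto
        then show "real (card {p \<in> lattice_paths z n. distinct p}) \<le> real (?M ^ n)"
          using card_lattice_paths[of z n] by (simp only: of_nat_le_iff)
      qed (use q in auto)
      finally show ?thesis
        by (simp add: power_mult_distrib mult.commute)
    qed
    have "emeasure \<mu> (\<Inter>n. E n) \<le> ennreal ((q * ?M) ^ n)" for n
      using E_sets E_le[of n] emeasure_mono[of "\<Inter>n. E n" "E n" \<mu>] by (meson INT_lower UNIV_I order_trans)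
    moreover have "(\<lambda>n. ennreal ((q * ?M) ^ n)) \<longlonglongrightarrow> ennreal 0"
      using q by (intro tendsto_ennrealI LIMSEQ_power_zero) auto
    ultimately have "emeasure \<mu> (\<Inter>n. E n) \<le> ennreal 0"
      by (intro LIMSEQ_le_const) auto
    then have "(\<Inter>n. E n) \<in> null_sets \<mu>"
      using E_sets by (intro null_setsI) auto
    then have "AE \<xi> in \<mu>. \<xi> \<notin> (\<Inter>n. E n)"
      by (rule AE_not_in)
    then show ?thesis
    proof (rule AE_mp, intro AE_I2 impI notI)
      fix \<xi> assume \<xi>: "\<xi> \<in> space \<mu>" "\<xi> \<notin> (\<Inter>n. E n)"
        "\<forall>n. \<exists>p\<in>lattice_paths z n. distinct p \<and> (\<forall>y\<in>set p. occupied ?s \<xi> y)"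
      have "locally_finite \<xi>"
        using \<xi>(1) sets_eq_imp_space_eq[OF sets] by (simp add: space_conf_space)
      obtain n where n: "\<xi> \<notin> E n"
        using \<xi>(2) by blast
      obtain p where "p \<in> lattice_paths z n" "distinct p" "\<forall>y\<in>set p. occupied ?s \<xi> y"
        using \<xi>(3) by blast
      with n \<open>locally_finite \<xi>\<close> show False
        unfolding E_def occupied_def by blast
    qed
  qed
  then have "AE \<xi> in \<mu>. \<forall>z\<in>range (lattice_point ?s).
      \<not> (\<forall>n. \<exists>p\<in>lattice_paths z n. distinct p \<and> (\<forall>y\<in>set p. occupied ?s \<xi> y))"
    by (subst AE_ball_countable) (auto simp: countable_range_lattice_point)
  then show ?thesis
    by (rule eventually_mono) (use unbounded_component_path[OF R] in blast)
qed

section \<open>Absence of percolation\<close>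

theorem theorem3p3:
  fixes \<Phi> :: "(real ^ 'd) set \<Rightarrow> ereal"
  assumes "CARD('d) \<ge> 2"
    and "potential \<Phi>"
    and "locally_stable_intensity \<Phi>"
  shows "\<forall>R>0. \<exists>\<beta>_minus>0. \<forall>\<beta>. 0 < \<beta> \<and> \<beta> < \<beta>_minus \<longrightarrow>
    (\<forall>(P :: 'w measure) \<Xi>. point_process P \<Xi> \<and>
        distr P conf_space \<Xi> \<in> gibbs_measures (with_activity \<beta> \<Phi>) \<longrightarrow>
      (AE w in P. \<forall>C\<in>components (boolean_model R (\<Xi> w)). bounded C))"
proof (intro allI impI)
  fix R :: real
  assume R: "0 < R"
  have "locally_finite {0 :: real ^ 'd}"
    by (simp add: locally_finite_def)
  then have "\<Phi> {0} \<noteq> \<infinity>" "\<Phi> {0} \<noteq> -\<infinity>"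
    using assms(2) unfolding potential_def by auto
  then obtain \<phi> where \<phi>0: "\<Phi> {0} = ereal \<phi>"
    by (cases "\<Phi> {0}") auto
  have \<phi>: "\<Phi> {x} = ereal \<phi>" for x
    using assms(2) \<phi>0 unfolding potential_def by metis
  have activity: "activity \<Phi> = exp (- \<phi>)"
    by (simp add: activity_def \<phi>0)
  have wd: "well_defined \<Phi>"
    using assms(2) by (simp add: potential_def)
  obtain C0 where C0: "\<And>\<beta> \<mu>. 0 < \<beta> \<Longrightarrow> \<beta> \<le> exp (- \<phi>) \<Longrightarrow> \<mu> \<in> gibbs_measures (with_activity \<beta> \<Phi>) \<Longrightarrow>
      locally_stable \<mu> (\<lambda>x \<xi>. ennreal \<beta> * reduced_intensity \<Phi> x \<xi>) (\<beta> * C0)"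
    using assms(3) unfolding locally_stable_intensity_def activity by auto
  \<comment> \<open>The given constant might be negative.\<close>
  define C where "C = max C0 0"
  define V where "V = (2 * R) ^ DIM(real ^ 'd)"
  define m where "m = real (card (unit_steps :: (real ^ 'd) set))"
  \<comment> \<open>\<open>X\<close> dominates \<open>C\<close>, \<open>C * exp V\<close> and
    \<open>C * exp V * m\<close> at once, so \<open>\<beta> < 1 / X\<close> gives the three
    smallness conditions together; the added ones keep \<open>X\<close> positive.\<close>
  define X where "X = (C + 1) * exp V * (m + 1)"
  have C: "0 \<le> C" and m: "0 \<le> m" and V: "1 \<le> exp V"
    using R by (auto simp: C_def m_def V_def)
  have "1 * 1 * 1 \<le> X"
    unfolding X_def by (intro mult_mono) (use C m V in auto)
  then have X: "0 < X"
    by simp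
  have "C * 1 * 1 \<le> X" "C * exp V * 1 \<le> X" "C * exp V * m \<le> X"
    unfolding X_def by (intro mult_mono; use C m V in simp)+
  then have le_X: "C \<le> X" "C * exp V \<le> X" "C * exp V * m \<le> X"
    by simp_all
  show "\<exists>\<beta>_minus>0. \<forall>\<beta>. 0 < \<beta> \<and> \<beta> < \<beta>_minus \<longrightarrow>
    (\<forall>(P :: 'w measure) \<Xi>. point_process P \<Xi> \<and>
        distr P conf_space \<Xi> \<in> gibbs_measures (with_activity \<beta> \<Phi>) \<longrightarrow>
      (AE w in P. \<forall>C\<in>components (boolean_model R (\<Xi> w)). bounded C))"
  \<comment> \<open>Stability is assumed for activities up to that of \<open>\<Phi>\<close>, which
    accounts for the first bound; the second makes the path count summable against the occupation
    probabilities.\<close>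
  proof (intro exI[of _ "min (exp (- \<phi>)) (1 / X)"] conjI allI impI)
    show "0 < min (exp (- \<phi>)) (1 / X)"
      using X by simp
    fix \<beta> :: real and P :: "'w measure" and \<Xi>
    assume \<beta>: "0 < \<beta> \<and> \<beta> < min (exp (- \<phi>)) (1 / X)"
      and pp: "point_process P \<Xi> \<and> distr P conf_space \<Xi> \<in> gibbs_measures (with_activity \<beta> \<Phi>)"
    define \<mu> where "\<mu> = distr P conf_space \<Xi>"
    have small: "\<beta> * a < 1" if "a \<le> X" for a
    proof -
      have "\<beta> * a \<le> \<beta> * X"
        using \<beta> that by (intro mult_left_mono) auto
      also have "\<beta> * X < 1"
        using \<beta> X by (simp add: field_simps)
      finally show ?thesis .
    qed
    have "locally_stable \<mu> (\<lambda>x \<xi>. ennreal \<beta> * reduced_intensity \<Phi> x \<xi>) (\<beta> * C0)"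
      using \<beta> pp unfolding \<mu>_def by (intro C0) auto
    then have stable: "AE \<xi> in \<mu>. \<forall>x. reduced_intensity \<Phi> x \<xi> \<le> ennreal C"
      unfolding locally_stable_def
    proof (rule eventually_mono, intro allI)
      fix \<xi> :: "(real ^ 'd) set" and x
      assume "\<forall>x. ennreal \<beta> * reduced_intensity \<Phi> x \<xi> \<le> ennreal (\<beta> * C0)"
      then have "ennreal \<beta> * reduced_intensity \<Phi> x \<xi> \<le> ennreal (\<beta> * C0)"
        by blast
      also have "\<dots> \<le> ennreal (\<beta> * C)"
        using \<beta> by (intro ennreal_leI mult_left_mono) (auto simp: C_def)
      also have "\<dots> = ennreal \<beta> * ennreal C"
        using \<beta> C by (intro ennreal_mult) auto
      finally show "reduced_intensity \<Phi> x \<xi> \<le> ennreal C"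
        using \<beta> by (subst (asm) ennreal_mult_le_mult_iff) auto
    qed
    interpret stable_gibbs \<Phi> \<phi> \<beta> C \<mu>
    proof
      show "\<beta> * C \<le> 1"
        using small[OF le_X(1)] by simp
      show "\<mu> \<in> gibbs_measures (with_activity \<beta> \<Phi>)"
        using pp by (simp add: \<mu>_def)
    qed (use \<beta> in \<open>auto intro: wd \<phi> C stable\<close>)
    have "AE \<xi> in \<mu>. \<forall>C\<in>components (boolean_model R \<xi>). bounded C"
    proof (rule AE_bounded_components[OF sets_\<mu> R, of "\<beta> * C * exp V"])
      show "0 \<le> \<beta> * C * exp V" "\<beta> * C * exp V \<le> 1"
        using \<beta> C small[OF le_X(2)] by (simp_all add: mult.assoc)
      show "\<beta> * C * exp V * card (unit_steps :: (real ^ 'd) set) < 1"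
        using small[OF le_X(3)] by (simp add: m_def mult.assoc)
      have "emeasure lborel (lattice_cell (2 * R) z) \<le> ennreal V" for z :: "real ^ 'd"
        unfolding V_def using R by (intro emeasure_lattice_cell_le) simp
      moreover fix I :: "(real ^ 'd) set"
      assume "finite I"
      ultimately show "emeasure \<mu> {\<xi>. locally_finite \<xi> \<and> (\<forall>z\<in>I. \<xi> \<inter> lattice_cell (2 * R) z \<noteq> {})}
          \<le> ennreal (\<beta> * C * exp V) ^ card I"
        using R by (intro emeasure_meets_all_le disjoint_lattice_cell bounded_lattice_cell sets_lattice_cell) auto
    qed
    moreover have "\<Xi> \<in> P \<rightarrow>\<^sub>M conf_space"
      using pp by (simp add: point_process_def)
    ultimately show "AE w in P. \<forall>C\<in>components (boolean_model R (\<Xi> w)). bounded C"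
      unfolding \<mu>_def by (rule AE_distrD[rotated])
  qed
qed

end
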